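(* Let $\beta>2$ and let $f(x)=|x|\log^\beta(\max\{|x|,1\})$ for all $x\in\mathbb{Z}$. Then the total number of collisions of two independent simple random walks $X,X'$ on $\mathrm{Comb}(\mathbb{Z},f)$ started from the same vertex is almost surely finite, i.e. $|\{n: X_n=X'_n\}|<\infty$ almost surely.
   Context: For $f:\mathbb{Z}\to[0,\infty)$, the wedge comb $\mathrm{Comb}(\mathbb{Z},f)$ is the graph with vertex set $\mathbb{V}=\{(x,y): x,y\in\mathbb{Z},\ -f(x)\le y\le f(x)\}$ and edge set $\{[(x,n),(x,m)]: |m-n|=1\}\cup\{[(x,0),(y,0)]: |x-y|=1\}$ (edges between vertices of $\mathbb{V}$). The simple random walk on a graph is the discrete-time Markov chain that at each step jumps from the current vertex to a uniformly chosen neighbour. Here $\log^\beta(t)=(\log t)^\beta$. *)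

theory Defs
  imports "HOL-Probability.Probability"
begin

definition comb_verts :: "(int \<Rightarrow> real) \<Rightarrow> (int \<times> int) set" where
  "comb_verts f = {(x, y). - f x \<le> real_of_int y \<and> real_of_int y \<le> f x}"

text \<open>Undirected edges are two-element sets of vertices.\<close>

definition comb_edges :: "(int \<Rightarrow> real) \<Rightarrow> (int \<times> int) set set" where
  "comb_edges f =
     {{(x, n), (x, m)} | x n m.
        (x, n) \<in> comb_verts f \<and> (x, m) \<in> comb_verts f \<and> \<bar>m - n\<bar> = 1} \<union>
     {{(x, 0), (y, 0)} | x y.
        (x, 0) \<in> comb_verts f \<and> (y, 0) \<in> comb_verts f \<and> \<bar>x - y\<bar> = 1}"

definition neighbours :: "'v set set \<Rightarrow> 'v \<Rightarrow> 'v set" where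
  "neighbours E v = {w. {v, w} \<in> E}"

text \<open>
  The processes below live on an arbitrary probability space. The Markov property is
  required for conditioning on every history of positive probability. The definition is
  meant for graphs in which every vertex has finite nonzero degree, as \<open>pmf_of_set\<close> is
  unspecified on empty and on infinite sets; the wedge combs are of this kind.
\<close>

definition simple_random_walk ::
  "'a measure \<Rightarrow> 'v set set \<Rightarrow> 'v \<Rightarrow> (nat \<Rightarrow> 'a \<Rightarrow> 'v) \<Rightarrow> bool" where
  "simple_random_walk M E v X \<longleftrightarrow>
     (\<forall>n. X n \<in> measurable M (count_space UNIV)) \<and>
     (AE \<omega> in M. X 0 \<omega> = v) \<and>
     (\<forall>n h w. \<P>(\<omega> in M. \<forall>i\<le>n. X i \<omega> = h i) > 0 \<longrightarrow>
        \<P>(\<omega> in M. X (Suc n) \<omega> = w \<bar> \<forall>i\<le>n. X i \<omega> = h i) =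
          pmf (pmf_of_set (neighbours E (h n))) w)"

text \<open>
  Independence of the two processes as random elements of the product space of trajectories,
  not merely of the pairs of values at each single time.
\<close>

definition indep_processes ::
  "'a measure \<Rightarrow> (nat \<Rightarrow> 'a \<Rightarrow> 'v) \<Rightarrow> (nat \<Rightarrow> 'a \<Rightarrow> 'v) \<Rightarrow> bool" where
  "indep_processes M X X' \<longleftrightarrow>
     prob_space.indep_var M
       (\<Pi>\<^sub>M n\<in>UNIV. count_space UNIV) (\<lambda>\<omega> n. X n \<omega>)
       (\<Pi>\<^sub>M n\<in>UNIV. count_space UNIV) (\<lambda>\<omega> n. X' n \<omega>)"

end

theory Submission
  imports Defs "HOL-Real_Asymp.Real_Asymp"
begin

text \<open>
  The comb is recurrent, so the expected number of collisions is infinite and a plain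
  Borel-Cantelli argument fails. The remedy is to count a collision at \<open>(x, y)\<close> with weight
  \<open>1 / max 1 \<bar>y\<bar>\<close>. Two facts then give the theorem.

  \<^item> From a common starting vertex, two independent walks collect an expected weight of at least
    \<open>1 / 100\<close> (\<open>weighted_collisions_ge\<close>): at height \<open>y\<close> they stay in the same stretch of length
    of order \<open>y\<close> of the tooth for about \<open>y\<^sup>2\<close> steps and meet at each of these steps with
    probability at least of order \<open>1 / y\<close>.
  \<^item> The expected total weight of all collisions is finite (\<open>weighted_collisions_le\<close>).

  Decomposing according to the first collision at or after time \<open>k\<close>, the probability that there
  is one is at most \<open>100\<close> times the expected weight collected from time \<open>k\<close> on, which tends
  to \<open>0\<close> (\<open>emeasure_meet_le\<close>, \<open>AE_finite_meetings\<close>).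

  For the second fact let \<open>p\<^sub>n\<close> be the \<open>n\<close>-step transition probability to the root. The sum of
  \<open>p\<^sub>n(x, y)\<^sup>2\<close> over \<open>n\<close> is largest at the foot of the tooth, because the walk must pass through
  it (\<open>sum_squares_le_boundary\<close>), and at the foot it is \<open>O(1 / f x)\<close> (\<open>spine_sq_le\<close>). Summing
  the weights over one tooth costs a factor \<open>log (f x)\<close>, and \<open>log (f x) / f x\<close> is of order
  \<open>1 / (\<bar>x\<bar> log\<^sup>\<beta>\<^sup>-\<^sup>1 \<bar>x\<bar>)\<close>, which is summable exactly when \<open>\<beta> > 2\<close>.

  The bound \<open>O(1 / f r)\<close> at the spine vertex \<open>r\<close> comes from energy estimates. The part of the comb
  up to distance \<open>r\<close> has volume of order \<open>r * f r\<close>, and its relaxation time is of order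
  \<open>r\<^sup>2 * f r\<close>. The Dirichlet energy of the heat kernel is the decrement of the return
  probability (\<open>energy_smooth\<close>), so a Poincare inequality on a rectangle of teeth gives the decay
  of the return probability (\<open>ret_le\<close>). After the relaxation time the heat kernel at \<open>r\<close> is
  compared along the spine with its value at the root (\<open>late_spine_sq_le\<close>). Before the relaxation
  time the sum at \<open>r\<close> is at most the sum at any spine vertex between the root and \<open>r\<close>, and hence
  at most an average over a whole rectangle of teeth, up to an energy term that is small except at
  very early times, when an exponential moment bound shows that \<open>r\<close> has hardly been reached
  (\<open>early_spine_sq_le\<close>).
\<close>

section \<open>Averaging over neighbours and transition probabilities\<close>

definition avg :: "('v \<Rightarrow> 'v set) \<Rightarrow> ('v \<Rightarrow> real) \<Rightarrow> 'v \<Rightarrow> real" where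
  "avg N u a = (\<Sum>z\<in>N a. u z) / real (card (N a))"

text \<open>
  The recursion acts on the starting vertex \<open>a\<close>: for a fixed target \<open>b\<close>
  this is the solution of the heat equation \<open>u (Suc n) = avg N (u n)\<close> that starts
  from the indicator of \<open>b\<close>.
\<close>

definition trans_prob :: "('v \<Rightarrow> 'v set) \<Rightarrow> nat \<Rightarrow> 'v \<Rightarrow> 'v \<Rightarrow> real" where
  "trans_prob N n a b = (avg N ^^ n) (\<lambda>z. if z = b then 1 else 0) a"

lemma trans_prob_0: "trans_prob N 0 a b = (if a = b then 1 else 0)"
  by (simp add: trans_prob_def)

lemma trans_prob_Suc: "trans_prob N (Suc n) a b = avg N (\<lambda>z. trans_prob N n z b) a"
  by (simp add: trans_prob_def)

lemma avg_mono: "(\<And>z. z \<in> N a \<Longrightarrow> u z \<le> v z) \<Longrightarrow> avg N u a \<le> avg N v a"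
  unfolding avg_def by (intro divide_right_mono sum_mono) auto

lemma avg_nonneg: "(\<And>z. z \<in> N a \<Longrightarrow> 0 \<le> u z) \<Longrightarrow> 0 \<le> avg N u a"
  unfolding avg_def by (intro divide_nonneg_nonneg sum_nonneg) auto

lemma avg_add: "avg N (\<lambda>z. u z + v z) a = avg N u a + avg N v a"
  unfolding avg_def by (simp add: sum.distrib add_divide_distrib)

lemma avg_diff: "avg N (\<lambda>z. u z - v z) a = avg N u a - avg N v a"
  unfolding avg_def by (simp add: sum_subtractf diff_divide_distrib)

lemma avg_scale: "avg N (\<lambda>z. c * u z) a = c * avg N u a"
  unfolding avg_def by (simp add: sum_distrib_left)

lemma avg_sum: "avg N (\<lambda>z. \<Sum>i\<in>I. u i z) a = (\<Sum>i\<in>I. avg N (u i) a)"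
  unfolding avg_def by (simp add: sum.swap[of _ I] sum_divide_distrib)

lemma avg_le_const:
  assumes "\<And>z. z \<in> N a \<Longrightarrow> u z \<le> c" "0 \<le> c"
  shows "avg N u a \<le> c"
proof (cases "card (N a) = 0")
  case False
  have "(\<Sum>z\<in>N a. u z) \<le> real (card (N a)) * c"
    using sum_bounded_above[of "N a" u c] assms by simp
  thus ?thesis using False unfolding avg_def by (simp add: divide_le_eq mult.commute)
qed (use assms in \<open>simp add: avg_def\<close>)

lemma avg_const:
  assumes "card (N a) \<noteq> 0" "\<And>z. z \<in> N a \<Longrightarrow> u z = c"
  shows "avg N u a = c"
  using assms unfolding avg_def by simp

lemma avg_square_le: "(avg N u a)\<^sup>2 \<le> avg N (\<lambda>z. (u z)\<^sup>2) a"
proof (cases "card (N a) = 0")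
  case False
  have "(\<Sum>z\<in>N a. u z)\<^sup>2 \<le> (\<Sum>z\<in>N a. (u z)\<^sup>2) * real (card (N a))"
    using Cauchy_Schwarz_ineq_sum[of u "\<lambda>_. 1" "N a"] by simp
  hence "(\<Sum>z\<in>N a. u z)\<^sup>2 / (real (card (N a)))\<^sup>2
      \<le> ((\<Sum>z\<in>N a. (u z)\<^sup>2) * real (card (N a))) / (real (card (N a)))\<^sup>2"
    by (rule divide_right_mono) simp
  thus ?thesis using False unfolding avg_def power_divide by (simp add: power2_eq_square[of "real _"])
qed (simp add: avg_def)

lemma avg_pow_mono:
  assumes "\<And>z. u z \<le> v z" shows "(avg N ^^ n) u a \<le> (avg N ^^ n) v a"
  by (induction n arbitrary: a) (auto intro: avg_mono assms)

lemma avg_pow_scale: "(avg N ^^ n) (\<lambda>z. c * u z) a = c * (avg N ^^ n) u a"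
proof (induction n arbitrary: a)
  case (Suc n)
  have "(avg N ^^ n) (\<lambda>z. c * u z) = (\<lambda>z. c * (avg N ^^ n) u z)" using Suc by blast
  thus ?case by (simp add: avg_scale)
qed simp

lemma avg_pow_diff: "(avg N ^^ n) (\<lambda>z. u z - v z) a = (avg N ^^ n) u a - (avg N ^^ n) v a"
proof (induction n arbitrary: a)
  case (Suc n)
  have "(avg N ^^ n) (\<lambda>z. u z - v z) = (\<lambda>z. (avg N ^^ n) u z - (avg N ^^ n) v z)" using Suc by blast
  thus ?case by (simp add: avg_diff)
qed simp

lemma avg_pow_sum: "(avg N ^^ n) (\<lambda>z. \<Sum>i\<in>I. u i z) a = (\<Sum>i\<in>I. (avg N ^^ n) (u i) a)"
proof (induction n arbitrary: a)
  case (Suc n)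
  have "(avg N ^^ n) (\<lambda>z. \<Sum>i\<in>I. u i z) = (\<lambda>z. \<Sum>i\<in>I. (avg N ^^ n) (u i) z)" using Suc by blast
  thus ?case by (simp add: avg_sum)
qed simp

lemma trans_prob_nonneg: "0 \<le> trans_prob N n a b"
  by (induction n arbitrary: a) (auto simp: trans_prob_0 trans_prob_Suc intro: avg_nonneg)

lemma trans_prob_set:
  assumes "finite S"
  shows "(avg N ^^ n) (indicator S) a = (\<Sum>z\<in>S. trans_prob N n a z)"
proof -
  have "(indicator S :: _ \<Rightarrow> real) = (\<lambda>x. \<Sum>z\<in>S. if x = z then 1 else 0)"
    using assms by (auto simp: indicator_def fun_eq_iff)
  thus ?thesis by (simp add: avg_pow_sum trans_prob_def)
qed

text \<open>
  One way to go from \<open>a\<close> to \<open>b\<close> is through \<open>v\<close> at time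
  \<open>n\<close>.
\<close>

lemma trans_prob_add_ge:
  "trans_prob N n a v * trans_prob N d v b \<le> trans_prob N (n + d) a b"
proof -
  have "trans_prob N (n + d) a b = (avg N ^^ n) (\<lambda>z. trans_prob N d z b) a"
    by (simp add: trans_prob_def funpow_add)
  also have "\<dots> \<ge> (avg N ^^ n) (\<lambda>z. trans_prob N d v b * (if z = v then 1 else 0)) a"
    by (intro avg_pow_mono) (simp add: trans_prob_nonneg)
  finally show ?thesis
    unfolding avg_pow_scale by (simp add: trans_prob_def mult.commute)
qed

text \<open>
  A solution of the heat equation that starts from zero on \<open>R\<close> is fed only through
  the boundary vertex \<open>b\<close>: inside \<open>R\<close> it is the convolution in time of
  its values at \<open>b\<close> with a hitting time distribution, so its square sum in time
  cannot exceed that at \<open>b\<close>. Instead of working with the convolution, the induction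
  on the time horizon uses that, by Jensen's inequality, the square sum up to time \<open>T +
  1\<close> is at most the neighbour average of the square sum up to time \<open>T\<close>.
\<close>

lemma sum_squares_le_boundary:
  assumes bd: "\<And>a. a \<in> R \<Longrightarrow> N a \<subseteq> insert b R"
    and zero: "\<And>a. a \<in> R \<Longrightarrow> u 0 a = 0"
    and heat: "\<And>n a. a \<in> R \<Longrightarrow> u (Suc n) a = avg N (u n) a"
    and "z \<in> R"
  shows "(\<Sum>m<T. (u m z)\<^sup>2) \<le> (\<Sum>m<T. (u m b)\<^sup>2)"
  using \<open>z \<in> R\<close>
proof (induction T arbitrary: z)
  case (Suc T)
  have "(\<Sum>m<Suc T. (u m z)\<^sup>2) = (\<Sum>m<T. (u (Suc m) z)\<^sup>2)"
    using zero[OF Suc.prems] by (simp only: sum.lessThan_Suc_shift) simp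
  also have "\<dots> \<le> (\<Sum>m<T. avg N (\<lambda>y. (u m y)\<^sup>2) z)"
    by (intro sum_mono) (simp add: heat[OF Suc.prems] avg_square_le)
  also have "\<dots> = avg N (\<lambda>y. \<Sum>m<T. (u m y)\<^sup>2) z" by (simp add: avg_sum)
  also have "\<dots> \<le> (\<Sum>m<T. (u m b)\<^sup>2)"
    using bd[OF Suc.prems] Suc.IH by (intro avg_le_const) (auto intro: sum_nonneg)
  also have "\<dots> \<le> (\<Sum>m<Suc T. (u m b)\<^sup>2)" by simp
  finally show ?case .
qed simp

lemma trans_prob_automorphism:
  assumes "inj \<phi>" "\<And>a. N (\<phi> a) = \<phi> ` N a"
  shows "trans_prob N n (\<phi> a) (\<phi> b) = trans_prob N n a b"
proof (induction n arbitrary: a)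
  case 0
  show ?case using assms(1) by (simp add: trans_prob_0 inj_eq)
next
  case (Suc n)
  have inj: "inj_on \<phi> (N a)" using assms(1) by (meson inj_on_subset subset_UNIV)
  show ?case
    unfolding trans_prob_Suc avg_def assms(2) card_image[OF inj]
    by (simp add: sum.reindex[OF inj] Suc.IH)
qed

section \<open>Reversibility and the Dirichlet form\<close>

text \<open>
  Isolated vertices are allowed: the average over an empty neighbourhood is \<open>0\<close>,
  which keeps the identity \<open>deg a * avg N u a = (\<Sum>z\<in>N a. u z)\<close> valid on the
  whole type, so that vertices outside the comb need no separate treatment.
\<close>

locale undirected =
  fixes N :: "'v \<Rightarrow> 'v set"
  assumes finite_nbrs: "finite (N a)"
    and nbrs_sym: "b \<in> N a \<Longrightarrow> a \<in> N b"
begin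

lemma nbrs_iff: "b \<in> N a \<longleftrightarrow> a \<in> N b"
  using nbrs_sym by blast

abbreviation "deg a \<equiv> real (card (N a))"

text \<open>
  Closed balls. They carry the supports of the heat kernels, which lets all inner products below
  be finite sums.
\<close>

primrec reach :: "nat \<Rightarrow> 'v \<Rightarrow> 'v set" where
  "reach 0 a = {a}"
| "reach (Suc n) a = reach n a \<union> (\<Union>b\<in>reach n a. N b)"

lemma finite_reach: "finite (reach n a)"
  by (induction n) (auto simp: finite_nbrs)

declare reach.simps(2) [simp del]

lemma reach_mono: "m \<le> n \<Longrightarrow> reach m a \<subseteq> reach n a"
  by (induction n) (auto simp: le_Suc_eq reach.simps(2))

lemma nbrs_reach: "a \<in> reach n r \<Longrightarrow> N a \<subseteq> reach (Suc n) r"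
  by (auto simp: reach.simps(2))

lemma trans_prob_support: "trans_prob N n z a \<noteq> 0 \<Longrightarrow> z \<in> reach n a"
proof (induction n arbitrary: z)
  case (Suc n)
  then obtain y where "y \<in> N z" "trans_prob N n y a \<noteq> 0"
    unfolding trans_prob_Suc avg_def by (auto dest: sum.not_neutral_contains_not_neutral)
  thus ?case using Suc.IH[of y] nbrs_sym[of y z] nbrs_reach[of y n a] by auto
qed (auto simp: trans_prob_0 split: if_splits)

lemma trans_prob_outside: "reach n a \<subseteq> S \<Longrightarrow> z \<notin> S \<Longrightarrow> trans_prob N n z a = 0"
  using trans_prob_support by blast

lemma deg_avg: "deg a * avg N u a = (\<Sum>z\<in>N a. u z)"
  using finite_nbrs[of a] by (auto simp: avg_def)

lemma avg_self_adjoint: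
  assumes S: "finite S" and u: "\<And>a. a \<notin> S \<Longrightarrow> u a = 0" and v: "\<And>a. a \<notin> S \<Longrightarrow> v a = 0"
  shows "(\<Sum>a\<in>S. deg a * (avg N u a * v a)) = (\<Sum>a\<in>S. deg a * (u a * avg N v a))"
proof -
  have restr: "(\<Sum>z\<in>N a. w z) = (\<Sum>z\<in>S. if z \<in> N a then w z else 0)"
    if "\<And>a. a \<notin> S \<Longrightarrow> w a = 0" for w :: "'v \<Rightarrow> real" and a
    using S finite_nbrs[of a] that
    by (simp add: sum.inter_restrict[symmetric] Int_commute[of S])
       (intro sum.mono_neutral_right, auto)
  have "(\<Sum>a\<in>S. deg a * (avg N u a * v a)) = (\<Sum>a\<in>S. \<Sum>z\<in>S. (if z \<in> N a then u z * v a else 0))"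
    by (intro sum.cong refl)
       (auto simp: mult.assoc[symmetric] deg_avg restr[OF u] sum_distrib_right intro!: sum.cong)
  also have "\<dots> = (\<Sum>a\<in>S. \<Sum>z\<in>S. (if z \<in> N a then u a * v z else 0))"
    by (subst sum.swap) (intro sum.cong refl, simp add: nbrs_iff)
  also have "\<dots> = (\<Sum>a\<in>S. u a * (deg a * avg N v a))"
    by (intro sum.cong refl)
       (auto simp: mult.assoc[symmetric] deg_avg restr[OF v] sum_distrib_left intro!: sum.cong)
  finally show ?thesis by (simp add: mult_ac)
qed

text \<open>
  Self-adjointness moves time steps from one kernel to the other until only an indicator is left.
  Reversibility, and later all norm and energy identities, are instances.
\<close>

lemma inner_trans_prob:
  assumes "finite S" "reach (i + j) a \<subseteq> S" "reach (i + j) b \<subseteq> S"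
  shows "(\<Sum>z\<in>S. deg z * (trans_prob N i z a * trans_prob N j z b)) = deg b * trans_prob N (i + j) b a"
  using assms
proof (induction j arbitrary: i)
  case 0
  have "b \<in> S" using 0 reach_mono[of 0 "i" b] by auto
  have "(\<Sum>z\<in>S. deg z * (trans_prob N i z a * trans_prob N 0 z b))
    = (\<Sum>z\<in>S. if z = b then deg b * trans_prob N i b a else 0)"
    by (intro sum.cong) (auto simp: trans_prob_0)
  thus ?case using \<open>b \<in> S\<close> 0 by simp
next
  case (Suc j)
  have "(\<Sum>z\<in>S. deg z * (trans_prob N i z a * trans_prob N (Suc j) z b))
    = (\<Sum>z\<in>S. deg z * (trans_prob N (Suc i) z a * trans_prob N j z b))"
    unfolding trans_prob_Suc
    using Suc.prems reach_mono[of i "i + Suc j" a] reach_mono[of j "i + Suc j" b]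
    by (intro avg_self_adjoint[symmetric] trans_prob_outside[where S = S]) auto
  also have "\<dots> = deg b * trans_prob N (i + Suc j) b a"
    using Suc.IH[of "Suc i"] Suc.prems by simp
  finally show ?case .
qed

lemma trans_prob_reversible: "deg a * trans_prob N n a b = deg b * trans_prob N n b a"
proof -
  let ?S = "reach n a \<union> reach n b"
  have "a \<in> ?S" using reach_mono[of 0 n a] by auto
  have "deg b * trans_prob N n b a = (\<Sum>z\<in>?S. deg z * (trans_prob N 0 z a * trans_prob N n z b))"
    using inner_trans_prob[of ?S 0 n a b] by (simp add: finite_reach)
  also have "\<dots> = (\<Sum>z\<in>?S. if z = a then deg a * trans_prob N n a b else 0)"
    by (intro sum.cong) (auto simp: trans_prob_0)
  finally show ?thesis using \<open>a \<in> ?S\<close> by (simp add: finite_reach)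
qed

text \<open>
  Summation by parts. The hypothesis on \<open>S\<close> says that no edge leaves \<open>S\<close>
  from the support of \<open>v\<close>, so there is no boundary term.
\<close>

lemma dirichlet_form:
  assumes S: "finite S" and v: "\<And>a. a \<in> S \<Longrightarrow> v a \<noteq> 0 \<Longrightarrow> N a \<subseteq> S"
  shows "(\<Sum>a\<in>S. deg a * (v a * (v a - avg N v a)))
    = (\<Sum>a\<in>S. \<Sum>z\<in>S. if z \<in> N a then (v a - v z)\<^sup>2 else 0) / 2" (is "?L = ?E / 2")
proof -
  have 1: "?L = (\<Sum>a\<in>S. \<Sum>z\<in>S. if z \<in> N a then v a * (v a - v z) else 0)"
  proof (intro sum.cong refl)
    fix a assume a: "a \<in> S"
    have "deg a * (v a * (v a - avg N v a)) = v a * (deg a * v a - deg a * avg N v a)"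
      by (simp add: algebra_simps)
    also have "\<dots> = v a * (\<Sum>z\<in>N a. v a - v z)" by (simp add: deg_avg sum_subtractf)
    also have "\<dots> = (\<Sum>z\<in>N a. v a * (v a - v z))" by (simp add: sum_distrib_left)
    also have "\<dots> = (\<Sum>z\<in>S. if z \<in> N a then v a * (v a - v z) else 0)"
    proof (cases "v a = 0")
      case False
      thus ?thesis using v[OF a] S
        by (simp add: sum.inter_restrict[symmetric] Int_absorb1)
    qed (simp cong: if_cong)
    finally show "deg a * (v a * (v a - avg N v a)) =
      (\<Sum>z\<in>S. if z \<in> N a then v a * (v a - v z) else 0)" .
  qed
  also have "\<dots> = (\<Sum>a\<in>S. \<Sum>z\<in>S. if z \<in> N a then v z * (v z - v a) else 0)"
    by (subst sum.swap) (intro sum.cong refl, simp add: nbrs_iff)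
  finally have "?L + ?L = (\<Sum>a\<in>S. \<Sum>z\<in>S. (if z \<in> N a then v a * (v a - v z) else 0)
      + (if z \<in> N a then v z * (v z - v a) else 0))"
    using 1 by (simp add: sum.distrib)
  also have "\<dots> = ?E"
    by (intro sum.cong refl) (auto simp: power2_eq_square algebra_simps)
  finally show ?thesis by simp
qed

section \<open>Return probabilities and energy dissipation\<close>

text \<open>
  On a bipartite graph such as the comb, the heat kernel at a single time oscillates between the
  two colour classes and its gradient is never small. Adding two consecutive times removes the
  oscillation; \<open>ret\<close> is the corresponding version of the return probability, and half
  of \<open>smooth\<close> is the heat kernel of a walk whose last step is lazy.
\<close>

definition ret :: "'v \<Rightarrow> nat \<Rightarrow> real" where
  "ret r n = trans_prob N (2 * n) r r + trans_prob N (2 * n + 1) r r"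

definition smooth :: "'v \<Rightarrow> nat \<Rightarrow> 'v \<Rightarrow> real" where
  "smooth r n a = trans_prob N n a r + trans_prob N (Suc n) a r"

lemma smooth_nonneg: "0 \<le> smooth r n a"
  by (simp add: smooth_def trans_prob_nonneg)

lemma trans_prob_le_smooth: "trans_prob N n a r \<le> smooth r n a"
  by (simp add: smooth_def trans_prob_nonneg)

lemma ret_nonneg: "0 \<le> ret r n"
  by (simp add: ret_def trans_prob_nonneg)

lemma avg_smooth: "avg N (smooth r n) a = smooth r (Suc n) a"
  unfolding smooth_def by (simp add: avg_add trans_prob_Suc)

lemma smooth_inner:
  assumes "finite S" "reach (n + m + 2) r \<subseteq> S"
  shows "(\<Sum>a\<in>S. deg a * (smooth r n a * smooth r m a)) =
    deg r * (trans_prob N (n + m) r r + 2 * trans_prob N (n + m + 1) r r + trans_prob N (n + m + 2) r r)"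
proof -
  have R: "reach k r \<subseteq> S" if "k \<le> n + m + 2" for k
    using reach_mono[OF that, of r] assms(2) by auto
  have "(\<Sum>a\<in>S. deg a * (smooth r n a * smooth r m a))
    = (\<Sum>a\<in>S. deg a * (trans_prob N n a r * trans_prob N m a r))
    + (\<Sum>a\<in>S. deg a * (trans_prob N n a r * trans_prob N (Suc m) a r))
    + (\<Sum>a\<in>S. deg a * (trans_prob N (Suc n) a r * trans_prob N m a r))
    + (\<Sum>a\<in>S. deg a * (trans_prob N (Suc n) a r * trans_prob N (Suc m) a r))"
    unfolding smooth_def sum.distrib[symmetric] by (intro sum.cong refl) (simp add: algebra_simps)
  thus ?thesis
    using R assms(1) by (simp add: inner_trans_prob algebra_simps)
qed

text \<open>
  The Dirichlet energy of \<open>smooth r n\<close> is the loss in the return probability from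
  \<open>n\<close> to \<open>Suc n\<close>, so the energies telescope in time. The set
  \<open>D\<close> lists edges, each in one direction only; every concrete estimate chooses the
  edges it can use.
\<close>

lemma energy_smooth:
  assumes D: "finite D" "\<And>a z. (a, z) \<in> D \<Longrightarrow> z \<in> N a" "\<And>a z. (a, z) \<in> D \<Longrightarrow> (z, a) \<notin> D"
  shows "(\<Sum>(a,z)\<in>D. (smooth r n a - smooth r n z)\<^sup>2) \<le> deg r * (ret r n - ret r (Suc n))"
proof -
  \<comment> \<open>Large enough for the supports of the kernels, for their neighbours and for the edges in \<open>D\<close>.\<close>
  define S where "S = reach (2 * n + 3) r \<union> fst ` D \<union> snd ` D"
  have fin: "finite S" using D(1) by (auto simp: S_def finite_reach)
  have sup: "N a \<subseteq> S" if "smooth r n a \<noteq> 0" for a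
  proof -
    have "a \<in> reach (Suc n) r"
      using that trans_prob_outside[of n r "reach (Suc n) r" a]
        trans_prob_outside[of "Suc n" r "reach (Suc n) r" a] reach_mono[of n "Suc n" r]
      unfolding smooth_def by fastforce
    hence "N a \<subseteq> reach (Suc (Suc n)) r" by (rule nbrs_reach)
    also have "\<dots> \<subseteq> reach (2 * n + 3) r" by (rule reach_mono) auto
    finally show ?thesis by (auto simp: S_def)
  qed
  let ?q = "\<lambda>p. (smooth r n (fst p) - smooth r n (snd p))\<^sup>2"
  let ?P = "{p \<in> S \<times> S. snd p \<in> N (fst p)}"
  let ?D' = "(\<lambda>(a,z). (z,a)) ` D"
  have "(\<Sum>p\<in>?D'. ?q p) = (\<Sum>p\<in>D. ?q p)"
    by (rule sum.reindex_cong[of "\<lambda>(a,z). (z,a)"])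
       (auto simp: inj_on_def power2_commute)
  hence "2 * (\<Sum>p\<in>D. ?q p) = (\<Sum>p\<in>D. ?q p) + (\<Sum>p\<in>?D'. ?q p)" by simp
  also have "\<dots> = (\<Sum>p\<in>D \<union> ?D'. ?q p)"
  proof (rule sum.union_disjoint[symmetric])
    show "D \<inter> ?D' = {}" using D(3) by fastforce
  qed (use D(1) in auto)
  also have "\<dots> \<le> (\<Sum>p\<in>?P. ?q p)"
  proof (rule sum_mono2)
    show "D \<union> ?D' \<subseteq> ?P"
    proof
      fix p assume "p \<in> D \<union> ?D'"
      then obtain a z where az: "(a, z) \<in> D" "p = (a, z) \<or> p = (z, a)"
        by (cases p) auto
      have "z \<in> N a" "a \<in> N z" using D(2)[OF az(1)] nbrs_sym by auto
      moreover have "a \<in> S" "z \<in> S" using az(1) unfolding S_def by force+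
      ultimately show "p \<in> ?P" using az(2) by auto
    qed
  qed (use fin in auto)
  also have "\<dots> = (\<Sum>a\<in>S. \<Sum>z\<in>S. if z \<in> N a then (smooth r n a - smooth r n z)\<^sup>2 else 0)"
    using fin by (subst sum.inter_filter) (auto simp: sum.cartesian_product case_prod_unfold)
  also have "\<dots> = 2 * (\<Sum>a\<in>S. deg a * (smooth r n a * (smooth r n a - avg N (smooth r n) a)))"
    using dirichlet_form[OF fin, of "smooth r n"] sup by simp
  also have "\<dots> = 2 * ((\<Sum>a\<in>S. deg a * (smooth r n a * smooth r n a)) -
      (\<Sum>a\<in>S. deg a * (smooth r n a * smooth r (Suc n) a)))"
    unfolding avg_smooth by (simp add: right_diff_distrib sum_subtractf)
  also have "\<dots> = 2 * (deg r * (ret r n - ret r (Suc n)))"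
  proof -
    have "reach (n + n + 2) r \<subseteq> S" "reach (n + Suc n + 2) r \<subseteq> S"
      using reach_mono[of "n+n+2" "2*n+3" r] reach_mono[of "n+Suc n+2" "2*n+3" r]
      unfolding S_def by auto
    note in1 = smooth_inner[OF fin this(1)] and in2 = smooth_inner[OF fin this(2)]
    have [simp]: "n + n = 2 * n" "n + Suc n = 2 * n + 1" by simp_all
    show ?thesis unfolding in1 in2 ret_def by (simp add: right_diff_distrib[symmetric])
  qed
  finally show ?thesis by (simp add: case_prod_unfold)
qed

lemma ret_decreasing_Suc:
  assumes "N r \<noteq> {}" shows "ret r (Suc n) \<le> ret r n"
proof -
  have "deg r > 0" using assms finite_nbrs[of r] by (simp add: card_gt_0_iff)
  thus ?thesis using energy_smooth[of "{}" r n] by (simp add: zero_le_mult_iff)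
qed

lemma ret_decreasing: "N r \<noteq> {} \<Longrightarrow> m \<le> n \<Longrightarrow> ret r n \<le> ret r m"
  using lift_Suc_antimono_le[of "ret r"] ret_decreasing_Suc by blast

text \<open>
  At even times the value is \<open>ret\<close> itself; at odd times it straddles two consecutive
  values.
\<close>

lemma smooth_root: 
  assumes "N r \<noteq> {}" shows "smooth r n r \<le> 2 * ret r (n div 2)"
proof (cases "even n")
  case True
  then obtain k where k: "n = 2 * k" by blast
  have "smooth r n r = ret r (n div 2)" unfolding k smooth_def ret_def by simp
  thus ?thesis using ret_nonneg[of r "n div 2"] by simp
next
  case False
  then obtain k where k: "n = 2 * k + 1" using oddE by blast
  have "smooth r n r \<le> ret r k + ret r (Suc k)"
    unfolding k smooth_def ret_def by (simp add: trans_prob_nonneg)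
  thus ?thesis using ret_decreasing_Suc[OF assms, of k] k by simp
qed

lemma sum_smooth_squares:
  assumes "N r \<noteq> {}" "finite B" "\<And>a. a \<in> B \<Longrightarrow> N a \<noteq> {}"
  shows "(\<Sum>a\<in>B. (smooth r n a)\<^sup>2) \<le> 3 * deg r * ret r n"
proof -
  define S where "S = reach (n + n + 2) r \<union> B"
  have fin: "finite S" using assms by (auto simp: S_def finite_reach)
  have "(\<Sum>a\<in>B. (smooth r n a)\<^sup>2) \<le> (\<Sum>a\<in>B. deg a * (smooth r n a)\<^sup>2)"
  proof (rule sum_mono)
    fix a assume "a \<in> B"
    hence "deg a \<ge> 1" using assms(3)[of a] finite_nbrs[of a] by (simp add: Suc_le_eq card_gt_0_iff)
    thus "(smooth r n a)\<^sup>2 \<le> deg a * (smooth r n a)\<^sup>2"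
      using mult_right_mono[of 1 "deg a" "(smooth r n a)\<^sup>2"] by simp
  qed
  also have "\<dots> \<le> (\<Sum>a\<in>S. deg a * (smooth r n a)\<^sup>2)"
    using fin by (intro sum_mono2) (auto simp: S_def)
  also have "\<dots> = deg r * (trans_prob N (n + n) r r + 2 * trans_prob N (n + n + 1) r r + trans_prob N (n + n + 2) r r)"
    unfolding power2_eq_square using fin by (intro smooth_inner) (simp_all add: S_def)
  also have "\<dots> \<le> deg r * (2 * ret r n + ret r (Suc n))"
    using trans_prob_nonneg[of N "2 * n" r r] trans_prob_nonneg[of N "2 * n + 3" r r]
    by (intro mult_left_mono) (simp_all add: ret_def mult_2[symmetric] numeral_3_eq_3)
  also have "\<dots> \<le> deg r * (3 * ret r n)"
    using ret_decreasing_Suc[OF assms(1)] by (intro mult_left_mono) auto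
  finally show ?thesis by simp
qed

end

section \<open>Collisions of independent walks\<close>

text \<open>
  \<open>V\<close> is a set of vertices that the walk cannot leave and on which the uniform
  distribution on the neighbours makes sense.
\<close>

locale walk = prob_space M + undirected "neighbours E"
  for M :: "'a measure" and E :: "'v::countable set set" +
  fixes V :: "'v set" and v :: 'v and X :: "nat \<Rightarrow> 'a \<Rightarrow> 'v"
  assumes start: "v \<in> V"
    and nbrs_V: "a \<in> V \<Longrightarrow> neighbours E a \<noteq> {} \<and> neighbours E a \<subseteq> V"
    and srw: "simple_random_walk M E v X"
begin

abbreviation "P \<equiv> trans_prob (neighbours E)"

lemma X_measurable [measurable]: "X n \<in> measurable M (count_space UNIV)"
  using srw by (simp add: simple_random_walk_def)

definition cylinder :: "nat \<Rightarrow> (nat \<Rightarrow> 'v) \<Rightarrow> 'a set" where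
  "cylinder n h = {\<omega> \<in> space M. \<forall>i\<le>n. X i \<omega> = h i}"

lemma cylinder_sets [measurable]: "cylinder n h \<in> sets M"
  unfolding cylinder_def by measurable

lemma P_1: "P (Suc 0) a b = (if b \<in> neighbours E a then 1 / deg a else 0)"
proof -
  have "(\<Sum>z\<in>neighbours E a. if z = b then 1 else 0 :: real) = (if b \<in> neighbours E a then 1 else 0)"
    using finite_nbrs[of a] by simp
  thus ?thesis by (simp add: trans_prob_Suc trans_prob_0 avg_def)
qed

lemma cylinder_step_cond:
  assumes "prob (cylinder n h) > 0" "h n \<in> V"
  shows "prob (cylinder n h \<inter> {\<omega> \<in> space M. X (Suc n) \<omega> = w}) = prob (cylinder n h) * P (Suc 0) (h n) w"
proof -
  have "\<P>(\<omega> in M. X (Suc n) \<omega> = w \<bar> \<forall>i\<le>n. X i \<omega> = h i) = pmf (pmf_of_set (neighbours E (h n))) w"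
    using srw assms(1) unfolding simple_random_walk_def cylinder_def by blast
  also have "\<dots> = P (Suc 0) (h n) w"
    using nbrs_V[OF assms(2)] finite_nbrs[of "h n"] by (simp add: P_1 pmf_of_set)
  finally have "prob {\<omega> \<in> space M. X (Suc n) \<omega> = w \<and> (\<forall>i\<le>n. X i \<omega> = h i)} / prob (cylinder n h)
      = P (Suc 0) (h n) w" by (simp add: cond_prob_def cylinder_def)
  moreover have "{\<omega> \<in> space M. X (Suc n) \<omega> = w \<and> (\<forall>i\<le>n. X i \<omega> = h i)}
      = cylinder n h \<inter> {\<omega> \<in> space M. X (Suc n) \<omega> = w}" by (auto simp: cylinder_def)
  ultimately show ?thesis using assms(1) by (simp add: field_simps)
qed

lemma cylinder_in_V: "prob (cylinder n h) > 0 \<Longrightarrow> h n \<in> V"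
proof (induction n)
  case 0
  have "h 0 = v"
  proof (rule ccontr)
    assume "h 0 \<noteq> v"
    moreover have "AE \<omega> in M. X 0 \<omega> = v" using srw by (simp add: simple_random_walk_def)
    ultimately have "AE \<omega> in M. \<omega> \<notin> cylinder 0 h" by (auto simp: cylinder_def)
    hence "prob (cylinder 0 h) = 0" by (simp add: prob_eq_0)
    thus False using 0 by simp
  qed
  thus ?case using start by simp
next
  case (Suc n)
  have eq: "cylinder (Suc n) h = cylinder n h \<inter> {\<omega> \<in> space M. X (Suc n) \<omega> = h (Suc n)}"
    by (auto simp: cylinder_def le_Suc_eq)
  have "prob (cylinder (Suc n) h) \<le> prob (cylinder n h)"
    by (rule finite_measure_mono) (auto simp: eq)
  hence pos: "prob (cylinder n h) > 0" using Suc.prems by simp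
  have "P (Suc 0) (h n) (h (Suc n)) \<noteq> 0"
    using cylinder_step_cond[OF pos Suc.IH[OF pos], of "h (Suc n)"] Suc.prems by (auto simp: eq)
  hence "h (Suc n) \<in> neighbours E (h n)" by (auto simp: P_1 split: if_splits)
  thus ?case using nbrs_V[OF Suc.IH[OF pos]] by blast
qed

text \<open>
  If the history has probability zero, the conditional law is not available, but then both sides
  vanish.
\<close>

lemma cylinder_step:
  "prob (cylinder n h \<inter> {\<omega> \<in> space M. X (Suc n) \<omega> = w}) = prob (cylinder n h) * P (Suc 0) (h n) w"
proof (cases "prob (cylinder n h) > 0")
  case True
  thus ?thesis using cylinder_step_cond cylinder_in_V by blast
next
  case False
  moreover have "prob (cylinder n h \<inter> {\<omega> \<in> space M. X (Suc n) \<omega> = w}) \<le> prob (cylinder n h)"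
    by (rule finite_measure_mono) auto
  ultimately show ?thesis by (simp add: not_less measure_le_0_iff)
qed

text \<open>
  The one-step probabilities of the finitely many neighbours already exhaust the mass.
\<close>

lemma cylinder_leaves_null:
  "prob (cylinder n h \<inter> {\<omega> \<in> space M. X (Suc n) \<omega> \<notin> neighbours E (h n)}) = 0"
proof (cases "prob (cylinder n h) > 0")
  case True
  let ?N = "neighbours E (h n)"
  have V: "h n \<in> V" using True by (rule cylinder_in_V)
  have deg: "deg (h n) > 0" using nbrs_V[OF V] finite_nbrs[of "h n"] by (simp add: card_gt_0_iff)
  let ?B = "\<lambda>w. cylinder n h \<inter> {\<omega> \<in> space M. X (Suc n) \<omega> = w}"
  have "prob (cylinder n h) = (\<Sum>w\<in>?N. prob (?B w)) + prob (cylinder n h \<inter> {\<omega> \<in> space M. X (Suc n) \<omega> \<notin> ?N})"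
  proof -
    have "cylinder n h = (\<Union>w\<in>?N. ?B w) \<union> (cylinder n h \<inter> {\<omega> \<in> space M. X (Suc n) \<omega> \<notin> ?N})"
      by (auto simp: cylinder_def)
    hence "prob (cylinder n h) = prob ((\<Union>w\<in>?N. ?B w) \<union> (cylinder n h \<inter> {\<omega> \<in> space M. X (Suc n) \<omega> \<notin> ?N}))"
      by simp
    also have "\<dots> = prob (\<Union>w\<in>?N. ?B w) + prob (cylinder n h \<inter> {\<omega> \<in> space M. X (Suc n) \<omega> \<notin> ?N})"
      by (rule finite_measure_Union) (auto intro!: sets.finite_UN finite_nbrs)
    also have "prob (\<Union>w\<in>?N. ?B w) = (\<Sum>w\<in>?N. prob (?B w))"
      by (rule finite_measure_finite_Union[OF finite_nbrs]) (auto simp: disjoint_family_on_def)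
    finally show ?thesis .
  qed
  moreover have "(\<Sum>w\<in>?N. prob (?B w)) = (\<Sum>w\<in>?N. prob (cylinder n h) * (1 / deg (h n)))"
    by (intro sum.cong refl) (simp add: cylinder_step P_1)
  ultimately show ?thesis using deg by simp
next
  case False
  moreover have "prob (cylinder n h \<inter> {\<omega> \<in> space M. X (Suc n) \<omega> \<notin> neighbours E (h n)}) \<le> prob (cylinder n h)"
    by (rule finite_measure_mono) auto
  ultimately show ?thesis by (simp add: not_less measure_le_0_iff)
qed

text \<open>
  The Markov property over \<open>m\<close> steps for a given history, by induction on
  \<open>m\<close>: the history is extended by one vertex.
\<close>

lemma cylinder_future:
  "prob (cylinder n h \<inter> {\<omega> \<in> space M. X (n + m) \<omega> = z}) = prob (cylinder n h) * P m (h n) z"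
proof (induction m arbitrary: n h)
  case 0
  have "cylinder n h \<inter> {\<omega> \<in> space M. X (n + 0) \<omega> = z} = (if h n = z then cylinder n h else {})"
    by (auto simp: cylinder_def)
  thus ?case by (simp add: trans_prob_0)
next
  case (Suc m)
  let ?N = "neighbours E (h n)" and ?G = "{\<omega> \<in> space M. X (n + Suc m) \<omega> = z}"
  let ?B = "\<lambda>w. cylinder n h \<inter> {\<omega> \<in> space M. X (Suc n) \<omega> = w} \<inter> ?G"
  let ?R = "cylinder n h \<inter> {\<omega> \<in> space M. X (Suc n) \<omega> \<notin> ?N} \<inter> ?G"
  have R0: "prob ?R = 0"
  proof -
    have "prob ?R \<le> prob (cylinder n h \<inter> {\<omega> \<in> space M. X (Suc n) \<omega> \<notin> ?N})"
      by (rule finite_measure_mono) auto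
    thus ?thesis by (simp add: cylinder_leaves_null measure_le_0_iff)
  qed
  have "cylinder n h \<inter> ?G = (\<Union>w\<in>?N. ?B w) \<union> ?R" by (auto simp: cylinder_def)
  hence "prob (cylinder n h \<inter> ?G) = prob ((\<Union>w\<in>?N. ?B w) \<union> ?R)" by simp
  also have "\<dots> = prob (\<Union>w\<in>?N. ?B w) + prob ?R"
    by (rule finite_measure_Union) (auto intro!: sets.finite_UN finite_nbrs)
  also have "prob (\<Union>w\<in>?N. ?B w) = (\<Sum>w\<in>?N. prob (?B w))"
    by (rule finite_measure_finite_Union[OF finite_nbrs]) (auto simp: disjoint_family_on_def)
  also have "\<dots> = (\<Sum>w\<in>?N. prob (cylinder n h) * (1 / deg (h n)) * P m w z)"
  proof (intro sum.cong refl)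
    fix w assume w: "w \<in> ?N"
    let ?h = "h(Suc n := w)"
    have p: "cylinder (Suc n) ?h = cylinder n h \<inter> {\<omega> \<in> space M. X (Suc n) \<omega> = w}"
      by (auto simp: cylinder_def le_Suc_eq)
    have "prob (?B w) = prob (cylinder (Suc n) ?h) * P m (?h (Suc n)) z"
      using Suc.IH[of "Suc n" ?h] unfolding p by simp
    also have "prob (cylinder (Suc n) ?h) = prob (cylinder n h) * (1 / deg (h n))"
      using w by (simp add: p cylinder_step P_1)
    finally show "prob (?B w) = prob (cylinder n h) * (1 / deg (h n)) * P m w z" by simp
  qed
  also have "\<dots> = prob (cylinder n h) * P (Suc m) (h n) z"
    by (simp add: trans_prob_Suc avg_def sum_distrib_left sum_divide_distrib)
  finally show ?case using R0 by simp
qed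

lemma prob_X: "prob {\<omega> \<in> space M. X n \<omega> = a} = P n v a"
proof -
  have AE: "AE \<omega> in M. X 0 \<omega> = v" using srw by (simp add: simple_random_walk_def)
  have "prob (cylinder 0 (\<lambda>_. v)) = 1"
    by (subst prob_eq_1) (use AE in \<open>auto simp: cylinder_def\<close>)
  moreover have "prob {\<omega> \<in> space M. X n \<omega> = a} = prob (cylinder 0 (\<lambda>_. v) \<inter> {\<omega> \<in> space M. X (0 + n) \<omega> = a})"
    by (rule finite_measure_eq_AE) (use AE in \<open>auto simp: cylinder_def\<close>)
  ultimately show ?thesis using cylinder_future[of 0 "\<lambda>_. v" n a] by simp
qed

text \<open>
  By reversibility the reachable vertices are those from which the start can be reached.
\<close>

lemma AE_X_reach: "AE \<omega> in M. X n \<omega> \<in> reach n v"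
proof -
  have "AE \<omega> in M. X n \<omega> \<noteq> a" if "a \<notin> reach n v" for a
  proof -
    have "deg v * P n v a = deg a * P n a v" by (rule trans_prob_reversible)
    moreover have "P n a v = 0" using that trans_prob_support by blast
    moreover have "deg v \<noteq> 0" using nbrs_V[OF start] finite_nbrs[of v] by simp
    ultimately have "prob {\<omega> \<in> space M. X n \<omega> = a} = 0" by (simp add: prob_X)
    thus ?thesis by (simp add: prob_eq_0)
  qed
  hence "AE \<omega> in M. \<forall>a\<in>- reach n v. X n \<omega> \<noteq> a"
    by (intro AE_ball_countable[THEN iffD2]) auto
  thus ?thesis by eventually_elim auto
qed

end

locale two_walks = X: walk M E V v X + X': walk M E V v X'
  for M :: "'a measure" and E :: "'v::countable set set" and V v X X' +
  assumes indep: "indep_processes M X X'"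
begin

abbreviation "P \<equiv> trans_prob (neighbours E)"

lemma prob_indep:
  assumes [measurable]: "A \<in> sets (\<Pi>\<^sub>M n\<in>(UNIV::nat set). count_space (UNIV::'v set))"
    "B \<in> sets (\<Pi>\<^sub>M n\<in>(UNIV::nat set). count_space (UNIV::'v set))"
  shows "X.prob {\<omega> \<in> space M. (\<lambda>n. X n \<omega>) \<in> A \<and> (\<lambda>n. X' n \<omega>) \<in> B}
    = X.prob {\<omega> \<in> space M. (\<lambda>n. X n \<omega>) \<in> A} * X.prob {\<omega> \<in> space M. (\<lambda>n. X' n \<omega>) \<in> B}"
  using X.indep_varD[OF indep[unfolded indep_processes_def] assms]
  by (simp add: vimage_def Int_def conj_ac)

text \<open>
  Independence of the two trajectories, applied to cylinder sets, turns the Markov property of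
  each walk into that of the pair.
\<close>

lemma prob_joint:
  "X.prob ((X.cylinder n h \<inter> {\<omega> \<in> space M. X (n + m) \<omega> = z}) \<inter> (X'.cylinder n h' \<inter> {\<omega> \<in> space M. X' (n + m) \<omega> = z'}))
   = X.prob (X.cylinder n h) * X.prob (X'.cylinder n h') * (P m (h n) z * P m (h' n) z')"
proof -
  define C where "C h z = {t :: nat \<Rightarrow> 'v. (\<forall>i\<le>n. t i = h i) \<and> t (n + m) = z}" for h z
  have C: "C h z \<in> sets (\<Pi>\<^sub>M n\<in>(UNIV::nat set). count_space (UNIV::'v set))" for h z
  proof -
    have "{t \<in> space (\<Pi>\<^sub>M n\<in>(UNIV::nat set). count_space (UNIV::'v set)). (\<forall>i\<le>n. t i = h i) \<and> t (n + m) = z}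
      \<in> sets (\<Pi>\<^sub>M n\<in>(UNIV::nat set). count_space (UNIV::'v set))" by measurable
    thus ?thesis by (simp add: C_def space_PiM)
  qed
  have "X.prob ((X.cylinder n h \<inter> {\<omega> \<in> space M. X (n + m) \<omega> = z}) \<inter> (X'.cylinder n h' \<inter> {\<omega> \<in> space M. X' (n + m) \<omega> = z'}))
    = X.prob {\<omega> \<in> space M. (\<lambda>n. X n \<omega>) \<in> C h z \<and> (\<lambda>n. X' n \<omega>) \<in> C h' z'}"
    by (rule arg_cong[where f = X.prob]) (auto simp: X.cylinder_def X'.cylinder_def C_def)
  also have "\<dots> = X.prob {\<omega> \<in> space M. (\<lambda>n. X n \<omega>) \<in> C h z} * X.prob {\<omega> \<in> space M. (\<lambda>n. X' n \<omega>) \<in> C h' z'}"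
    by (rule prob_indep[OF C C])
  also have "{\<omega> \<in> space M. (\<lambda>n. X n \<omega>) \<in> C h z} = X.cylinder n h \<inter> {\<omega> \<in> space M. X (n + m) \<omega> = z}"
    by (auto simp: X.cylinder_def C_def)
  also have "{\<omega> \<in> space M. (\<lambda>n. X' n \<omega>) \<in> C h' z'} = X'.cylinder n h' \<inter> {\<omega> \<in> space M. X' (n + m) \<omega> = z'}"
    by (auto simp: X'.cylinder_def C_def)
  finally show ?thesis by (simp add: X.cylinder_future X'.cylinder_future)
qed

lemma prob_joint_paths: "X.prob (X.cylinder n h \<inter> X'.cylinder n h') = X.prob (X.cylinder n h) * X.prob (X'.cylinder n h')"
proof -
  have "(X.cylinder n h \<inter> {\<omega> \<in> space M. X (n + 0) \<omega> = h n}) \<inter> (X'.cylinder n h' \<inter> {\<omega> \<in> space M. X' (n + 0) \<omega> = h' n})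
     = X.cylinder n h \<inter> X'.cylinder n h'" by (auto simp: X.cylinder_def X'.cylinder_def)
  thus ?thesis using prob_joint[of n h 0 "h n" h' "h' n"] by (simp add: trans_prob_0)
qed

lemma prob_meet: "X.prob {\<omega> \<in> space M. X n \<omega> = a \<and> X' n \<omega> = a} = (P n v a)\<^sup>2"
proof -
  define C where "C = {t :: nat \<Rightarrow> 'v. t n = a}"
  have C: "C \<in> sets (\<Pi>\<^sub>M n\<in>(UNIV::nat set). count_space (UNIV::'v set))"
  proof -
    have "{t \<in> space (\<Pi>\<^sub>M n\<in>(UNIV::nat set). count_space (UNIV::'v set)). t n = a}
      \<in> sets (\<Pi>\<^sub>M n\<in>(UNIV::nat set). count_space (UNIV::'v set))" by measurable
    thus ?thesis by (simp add: C_def space_PiM)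
  qed
  show ?thesis using prob_indep[OF C C] X.prob_X[of n a] X'.prob_X[of n a]
    by (simp add: C_def power2_eq_square)
qed

definition score :: "('v \<Rightarrow> real) \<Rightarrow> nat \<Rightarrow> 'a \<Rightarrow> ennreal" where
  "score g n \<omega> = (if X n \<omega> = X' n \<omega> then ennreal (g (X n \<omega>)) else 0)"

lemma score_measurable [measurable]: "score g n \<in> borel_measurable M"
  unfolding score_def by measurable

lemma score_integral:
  assumes g: "\<And>a. 0 \<le> g a"
  shows "(\<integral>\<^sup>+\<omega>. score g n \<omega> \<partial>M) = ennreal (\<Sum>a\<in>X.reach n v. (P n v a)\<^sup>2 * g a)"
proof -
  let ?R = "X.reach n v"
  let ?I = "\<lambda>a. {\<omega> \<in> space M. X n \<omega> = a \<and> X' n \<omega> = a}"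
  have "(\<integral>\<^sup>+\<omega>. score g n \<omega> \<partial>M) = (\<integral>\<^sup>+\<omega>. (\<Sum>a\<in>?R. ennreal (g a) * indicator (?I a) \<omega>) \<partial>M)"
  proof (rule nn_integral_cong_AE)
    show "AE \<omega> in M. score g n \<omega> = (\<Sum>a\<in>?R. ennreal (g a) * indicator (?I a) \<omega>)"
      using X.AE_X_reach[of n] AE_space
    proof eventually_elim
      case (elim \<omega>)
      have "(\<Sum>a\<in>?R. ennreal (g a) * indicator (?I a) \<omega>)
        = (\<Sum>a\<in>?R. if a = X n \<omega> then score g n \<omega> else 0)"
        using elim by (intro sum.cong refl) (auto simp: score_def indicator_def)
      thus ?case using elim X.finite_reach by simp
    qed
  qed
  also have "\<dots> = (\<Sum>a\<in>?R. ennreal (g a) * emeasure M (?I a))"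
    by (subst nn_integral_sum) (auto simp: nn_integral_cmult_indicator)
  also have "\<dots> = (\<Sum>a\<in>?R. ennreal ((P n v a)\<^sup>2 * g a))"
    using g by (simp add: X.emeasure_eq_measure prob_meet ennreal_mult' mult.commute)
  also have "\<dots> = ennreal (\<Sum>a\<in>?R. (P n v a)\<^sup>2 * g a)" using g by (intro sum_ennreal) auto
  finally show ?thesis .
qed

text \<open>
  A nonempty list of length \<open>n + 1\<close> records both walks at the times \<open>0,
  \<dots>, n\<close>. There are only countably many lists, which allows sums over histories.
\<close>

definition history :: "('v \<times> 'v) list \<Rightarrow> 'a set" where
  "history l = X.cylinder (length l - 1) (\<lambda>i. fst (l ! i)) \<inter> X'.cylinder (length l - 1) (\<lambda>i. snd (l ! i))"

lemma history_iff:
  "l \<noteq> [] \<Longrightarrow> \<omega> \<in> history l \<longleftrightarrow> \<omega> \<in> space M \<and> (\<forall>i<length l. X i \<omega> = fst (l ! i) \<and> X' i \<omega> = snd (l ! i))"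
  unfolding history_def X.cylinder_def X'.cylinder_def by (cases l) (auto simp: less_Suc_eq_le)

lemma history_sets [measurable]: "history l \<in> sets M"
  unfolding history_def by (intro sets.Int X.cylinder_sets X'.cylinder_sets)

text \<open>
  The histories that end at the first collision at or after time \<open>k\<close>. No such list
  extends another one, which is why their events are disjoint.
\<close>

definition first_meetings :: "nat \<Rightarrow> ('v \<times> 'v) list set" where
  "first_meetings k = {l. k < length l \<and> fst (last l) = snd (last l) \<and>
     (\<forall>i. k \<le> i \<longrightarrow> i < length l - 1 \<longrightarrow> fst (l ! i) \<noteq> snd (l ! i))}"

lemma first_meetings_disjoint: "disjoint_family_on history (first_meetings k)"
proof -
  have no: "length l1 = length l2" if l: "l1 \<in> first_meetings k" "l2 \<in> first_meetings k"
    and \<omega>: "\<omega> \<in> history l1" "\<omega> \<in> history l2" for l1 l2 \<omega>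
  proof -
    have le: "\<not> length l1 < length l2" if l: "l1 \<in> first_meetings k" "l2 \<in> first_meetings k"
      and \<omega>: "\<omega> \<in> history l1" "\<omega> \<in> history l2" for l1 l2
    proof
      assume lt: "length l1 < length l2"
      have ne: "l1 \<noteq> []" "l2 \<noteq> []" using l by (auto simp: first_meetings_def)
      let ?i = "length l1 - 1"
      have "X ?i \<omega> = X' ?i \<omega>"
        using \<omega>(1) l(1) ne by (auto simp: history_iff first_meetings_def last_conv_nth)
      moreover have "X ?i \<omega> \<noteq> X' ?i \<omega>"
        using \<omega>(2) l ne lt by (auto simp: history_iff first_meetings_def)
      ultimately show False by simp
    qed
    from le[OF l \<omega>] le[OF l(2,1) \<omega>(2,1)] show ?thesis by simp
  qed
  show ?thesis unfolding disjoint_family_on_def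
  proof (intro ballI impI, rule ccontr)
    fix l1 l2 assume l: "l1 \<in> first_meetings k" "l2 \<in> first_meetings k" "l1 \<noteq> l2"
      and "history l1 \<inter> history l2 \<noteq> {}"
    then obtain \<omega> where \<omega>: "\<omega> \<in> history l1" "\<omega> \<in> history l2" by blast
    have len: "length l1 = length l2" by (rule no[OF l(1,2) \<omega>])
    have ne: "l1 \<noteq> []" "l2 \<noteq> []" using l by (auto simp: first_meetings_def)
    have "l1 = l2"
      using \<omega> ne len by (intro nth_equalityI) (auto simp: history_iff prod_eq_iff)
    thus False using l(3) by simp
  qed
qed

lemma first_meetings_Union:
  "{\<omega> \<in> space M. \<exists>n\<ge>k. X n \<omega> = X' n \<omega>} = (\<Union>l\<in>first_meetings k. history l)" (is "?A = ?B")
proof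
  show "?A \<subseteq> ?B"
  proof
    fix \<omega> assume \<omega>: "\<omega> \<in> ?A"
    define n where "n = (LEAST n. k \<le> n \<and> X n \<omega> = X' n \<omega>)"
    have n: "k \<le> n \<and> X n \<omega> = X' n \<omega>" unfolding n_def by (rule LeastI_ex) (use \<omega> in auto)
    have min: "X i \<omega> \<noteq> X' i \<omega>" if "k \<le> i" "i < n" for i
      using not_less_Least[of i "\<lambda>n. k \<le> n \<and> X n \<omega> = X' n \<omega>"] that unfolding n_def by auto
    define l where "l = map (\<lambda>i. (X i \<omega>, X' i \<omega>)) [0..<Suc n]"
    have len: "length l = Suc n" and nth: "\<And>i. i < Suc n \<Longrightarrow> l ! i = (X i \<omega>, X' i \<omega>)"
      by (simp_all add: l_def del: upt_Suc)
    have ne: "l \<noteq> []" using len by auto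
    have "l \<in> first_meetings k"
      using n min ne by (auto simp: first_meetings_def last_conv_nth len nth)
    moreover have "\<omega> \<in> history l" using \<omega> ne by (auto simp: history_iff len nth)
    ultimately show "\<omega> \<in> ?B" by blast
  qed
  show "?B \<subseteq> ?A"
  proof
    fix \<omega> assume "\<omega> \<in> ?B"
    then obtain l where l: "l \<in> first_meetings k" "\<omega> \<in> history l" by blast
    have ne: "l \<noteq> []" using l by (auto simp: first_meetings_def)
    let ?n = "length l - 1"
    have "k \<le> ?n" "X ?n \<omega> = X' ?n \<omega>"
      using l ne by (auto simp: first_meetings_def history_iff last_conv_nth)
    thus "\<omega> \<in> ?A" using l ne by (auto simp: history_iff)
  qed
qed

text \<open>
  Whenever a collision occurs, the walks collect an expected weight of at least \<open>c\<close>
  from then on. For each history ending at the first collision at or after time \<open>k\<close>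
  this compares two measures: \<open>c\<close> times the probability, and the probability with
  density \<open>\<psi>\<close>, the weight collected from time \<open>k\<close> on. Countable
  additivity of both over the disjoint histories gives the claim.
\<close>

lemma emeasure_meet_le:
  assumes g: "\<And>a. 0 \<le> g a" and c: "0 < c"
    and lower: "\<And>a. a \<in> V \<Longrightarrow> \<exists>T S. finite S \<and> c \<le> (\<Sum>m<T. \<Sum>z\<in>S. (P m a z)\<^sup>2 * g z)"
  shows "ennreal c * emeasure M {\<omega> \<in> space M. \<exists>n\<ge>k. X n \<omega> = X' n \<omega>}
    \<le> (\<Sum>n. \<integral>\<^sup>+\<omega>. score g (n + k) \<omega> \<partial>M)"
proof -
  define \<psi> where "\<psi> \<omega> = (\<Sum>n. score g (n + k) \<omega>)" for \<omega>
  have [measurable]: "\<psi> \<in> borel_measurable M" unfolding \<psi>_def by measurable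
  have one: "ennreal c * emeasure M (history l) \<le> emeasure (density M \<psi>) (history l)"
    if l: "l \<in> first_meetings k" for l
  proof (cases "X.prob (history l) = 0")
    case True
    thus ?thesis by (simp add: X.emeasure_eq_measure)
  next
    case False
    define n where "n = length l - 1"
    define h where "h = (\<lambda>i. fst (l ! i))"
    define h' where "h' = (\<lambda>i. snd (l ! i))"
    have ne: "l \<noteq> []" and kn: "k \<le> n" using l by (auto simp: first_meetings_def n_def)
    have hn: "h' n = h n" using l ne by (auto simp: first_meetings_def last_conv_nth h_def h'_def n_def)
    have H: "history l = X.cylinder n h \<inter> X'.cylinder n h'" by (simp add: history_def n_def h_def h'_def)
    have pH: "X.prob (history l) = X.prob (X.cylinder n h) * X.prob (X'.cylinder n h')"
      unfolding H by (rule prob_joint_paths)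
    have "h n \<in> V" using False pH by (intro X.cylinder_in_V) (auto simp: zero_less_measure_iff)
    then obtain T S where S: "finite S" and low: "c \<le> (\<Sum>m<T. \<Sum>z\<in>S. (P m (h n) z)\<^sup>2 * g z)"
      using lower by blast
    let ?I = "\<lambda>m z. {\<omega> \<in> space M. X (n + m) \<omega> = z \<and> X' (n + m) \<omega> = z}"
    have pI: "X.prob (history l \<inter> ?I m z) = X.prob (history l) * (P m (h n) z)\<^sup>2" for m z
    proof -
      have "history l \<inter> ?I m z = (X.cylinder n h \<inter> {\<omega> \<in> space M. X (n + m) \<omega> = z}) \<inter> (X'.cylinder n h' \<inter> {\<omega> \<in> space M. X' (n + m) \<omega> = z})"
        by (auto simp: H)
      thus ?thesis using prob_joint[of n h m z h' z] by (simp add: pH hn power2_eq_square)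
    qed
    have "ennreal c * emeasure M (history l) = ennreal (c * X.prob (history l))"
      using c by (simp add: X.emeasure_eq_measure ennreal_mult)
    also have "\<dots> \<le> ennreal ((\<Sum>m<T. \<Sum>z\<in>S. (P m (h n) z)\<^sup>2 * g z) * X.prob (history l))"
      using low by (intro ennreal_leI mult_right_mono) auto
    also have "\<dots> = ennreal (\<Sum>m<T. \<Sum>z\<in>S. g z * X.prob (history l \<inter> ?I m z))"
      by (simp add: pI sum_distrib_left sum_distrib_right mult_ac)
    also have "\<dots> = (\<Sum>m<T. \<Sum>z\<in>S. ennreal (g z) * emeasure M (history l \<inter> ?I m z))"
      using g by (simp add: X.emeasure_eq_measure ennreal_mult' sum_nonneg flip: sum_ennreal)
    also have "\<dots> = (\<Sum>m<T. \<Sum>z\<in>S. \<integral>\<^sup>+\<omega>. ennreal (g z) * indicator (history l \<inter> ?I m z) \<omega> \<partial>M)"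
      by (intro sum.cong refl nn_integral_cmult_indicator[symmetric]) measurable
    also have "\<dots> = (\<integral>\<^sup>+\<omega>. (\<Sum>m<T. \<Sum>z\<in>S. ennreal (g z) * indicator (history l \<inter> ?I m z) \<omega>) \<partial>M)"
      by (subst nn_integral_sum, measurable, subst nn_integral_sum, measurable)
    also have "\<dots> \<le> (\<integral>\<^sup>+\<omega>. \<psi> \<omega> * indicator (history l) \<omega> \<partial>M)"
    proof (rule nn_integral_mono)
      fix \<omega> assume \<omega>: "\<omega> \<in> space M"
      show "(\<Sum>m<T. \<Sum>z\<in>S. ennreal (g z) * indicator (history l \<inter> ?I m z) \<omega>) \<le> \<psi> \<omega> * indicator (history l) \<omega>"
      proof (cases "\<omega> \<in> history l")
        case True
        have "(\<Sum>m<T. \<Sum>z\<in>S. ennreal (g z) * indicator (history l \<inter> ?I m z) \<omega>) \<le> (\<Sum>m<T. score g (n + m) \<omega>)"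
        proof (rule sum_mono)
          fix m
          have "(\<Sum>z\<in>S. ennreal (g z) * indicator (history l \<inter> ?I m z) \<omega>)
            \<le> (\<Sum>z\<in>S. if z = X (n + m) \<omega> then score g (n + m) \<omega> else 0)"
            by (intro sum_mono) (auto simp: score_def indicator_def)
          also have "\<dots> \<le> score g (n + m) \<omega>" using S by (simp add: sum.delta)
          finally show "(\<Sum>z\<in>S. ennreal (g z) * indicator (history l \<inter> ?I m z) \<omega>) \<le> score g (n + m) \<omega>" .
        qed
        also have "\<dots> = (\<Sum>j\<in>(\<lambda>m. n - k + m) ` {..<T}. score g (j + k) \<omega>)"
          using kn by (subst sum.reindex) (auto simp: inj_on_def add.commute add.left_commute)
        also have "\<dots> \<le> \<psi> \<omega>" unfolding \<psi>_def by (intro sum_le_suminf) auto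
        finally show ?thesis using True by simp
      qed (simp add: indicator_def)
    qed
    also have "\<dots> = emeasure (density M \<psi>) (history l)"
      by (rule emeasure_density[symmetric]) measurable
    finally show ?thesis .
  qed
  have cnt: "countable (first_meetings k)" by simp
  have "ennreal c * emeasure M {\<omega> \<in> space M. \<exists>n\<ge>k. X n \<omega> = X' n \<omega>}
      = ennreal c * (\<integral>\<^sup>+l. emeasure M (history l) \<partial>count_space (first_meetings k))"
    unfolding first_meetings_Union
    by (subst emeasure_UN_countable) (auto simp: first_meetings_disjoint)
  also have "\<dots> = (\<integral>\<^sup>+l. ennreal c * emeasure M (history l) \<partial>count_space (first_meetings k))"
    by (rule nn_integral_cmult[symmetric]) simp
  also have "\<dots> \<le> (\<integral>\<^sup>+l. emeasure (density M \<psi>) (history l) \<partial>count_space (first_meetings k))"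
    by (intro nn_integral_mono one) simp
  also have "\<dots> = emeasure (density M \<psi>) (\<Union>l\<in>first_meetings k. history l)"
    by (rule emeasure_UN_countable[symmetric]) (auto simp: first_meetings_disjoint)
  also have "\<dots> \<le> emeasure (density M \<psi>) (space (density M \<psi>))"
    by (rule emeasure_space)
  also have "\<dots> = (\<integral>\<^sup>+\<omega>. \<psi> \<omega> \<partial>M)" by (simp add: emeasure_density cong: nn_integral_cong)
  also have "\<dots> = (\<Sum>n. \<integral>\<^sup>+\<omega>. score g (n + k) \<omega> \<partial>M)"
    unfolding \<psi>_def by (rule nn_integral_suminf) measurable
  finally show ?thesis .
qed

text \<open>
  A criterion for finitely many collisions which does not need a finite expected number of them:
  the weight \<open>g\<close> may be chosen small where one collision makes many more likely.
\<close>

theorem AE_finite_meetings: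
  assumes g: "\<And>a. 0 \<le> g a" and c: "0 < c"
    and lower: "\<And>a. a \<in> V \<Longrightarrow> \<exists>T S. finite S \<and> c \<le> (\<Sum>m<T. \<Sum>z\<in>S. (P m a z)\<^sup>2 * g z)"
    and upper: "\<And>T B. finite B \<Longrightarrow> (\<Sum>n<T. \<Sum>a\<in>B. (P n v a)\<^sup>2 * g a) \<le> K"
  shows "AE \<omega> in M. finite {n. X n \<omega> = X' n \<omega>}"
proof -
  define r where "r n = (\<Sum>a\<in>X.reach n v. (P n v a)\<^sup>2 * g a)" for n
  have r0: "0 \<le> r n" for n unfolding r_def using g by (intro sum_nonneg mult_nonneg_nonneg) auto
  have partial: "(\<Sum>n<T. r n) \<le> K" for T
  proof -
    have "(\<Sum>n<T. r n) \<le> (\<Sum>n<T. \<Sum>a\<in>X.reach T v. (P n v a)\<^sup>2 * g a)"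
      unfolding r_def using X.reach_mono g
      by (intro sum_mono sum_mono2) (auto simp: X.finite_reach intro!: mult_nonneg_nonneg)
    also have "\<dots> \<le> K" by (rule upper[OF X.finite_reach])
    finally show ?thesis .
  qed
  have summable: "summable r"
    by (rule bounded_imp_summable[of r K]) (use r0 partial[of "Suc _"] in \<open>auto simp only: lessThan_Suc_atMost\<close>)
  define F where "F k = {\<omega> \<in> space M. \<exists>n\<ge>k. X n \<omega> = X' n \<omega>}" for k
  have [measurable]: "F k \<in> sets M" for k unfolding F_def by measurable
  have bound: "c * X.prob (F k) \<le> (\<Sum>n. r (n + k))" for k
  proof -
    have "ennreal (c * X.prob (F k)) = ennreal c * emeasure M (F k)"
      using c by (simp add: X.emeasure_eq_measure ennreal_mult)
    also have "\<dots> \<le> (\<Sum>n. ennreal (r (n + k)))"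
      using emeasure_meet_le[of g c k] g c lower by (simp add: F_def r_def score_integral)
    also have "\<dots> = ennreal (\<Sum>n. r (n + k))"
      using summable r0 by (intro suminf_ennreal2) (auto simp: summable_iff_shift)
    finally show ?thesis using r0 summable
      by (subst (asm) ennreal_le_iff) (auto intro!: suminf_nonneg simp: summable_iff_shift)
  qed
  have "X.prob (\<Inter>k. F k) \<le> e" if e: "0 < e" for e
  proof -
    obtain k where k: "norm (\<Sum>n. r (n + k)) < c * e"
      using suminf_exist_split[OF _ summable, of "c * e"] c e by auto
    have "c * X.prob (\<Inter>k. F k) \<le> c * X.prob (F k)"
      using c by (intro mult_left_mono X.finite_measure_mono) auto
    also have "\<dots> \<le> c * e" using bound[of k] k by simp
    finally show ?thesis using c by simp
  qed
  hence "X.prob (\<Inter>k. F k) = 0"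
    by (metis field_le_epsilon add_0 measure_le_0_iff)
  hence "AE \<omega> in M. \<omega> \<notin> (\<Inter>k. F k)" by (subst (asm) X.prob_eq_0) auto
  thus ?thesis using AE_space
  proof eventually_elim
    case (elim \<omega>)
    then obtain k where "\<forall>n\<ge>k. X n \<omega> \<noteq> X' n \<omega>" by (auto simp: F_def)
    hence "{n. X n \<omega> = X' n \<omega>} \<subseteq> {..<k}" by (auto simp: not_le[symmetric])
    thus ?case by (rule finite_subset) simp
  qed
qed

end

section \<open>Elementary inequalities\<close>

lemma telescope_square_le:
  fixes a :: "nat \<Rightarrow> real"
  shows "(a 0 - a n)\<^sup>2 \<le> real n * (\<Sum>i<n. (a i - a (Suc i))\<^sup>2)"
proof -
  have "a 0 - a n = (\<Sum>i<n. (a i - a (Suc i)) * 1)"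
    by (simp add: sum_lessThan_telescope')
  also have "\<dots>\<^sup>2 \<le> (\<Sum>i<n. (a i - a (Suc i))\<^sup>2) * (\<Sum>i<n. 1\<^sup>2)"
    by (rule Cauchy_Schwarz_ineq_sum)
  finally show ?thesis by (simp add: mult.commute)
qed

lemma square_le_double: "(a::real)\<^sup>2 \<le> 2 * b\<^sup>2 + 2 * (b - a)\<^sup>2"
proof -
  have "2 * b\<^sup>2 + 2 * (b - a)\<^sup>2 - a\<^sup>2 = (2 * b - a)\<^sup>2"
    by (simp add: power2_eq_square algebra_simps)
  thus ?thesis using zero_le_power2[of "2 * b - a"] by linarith
qed

lemma diff_square_le_double: "(a - c)\<^sup>2 \<le> 2 * (a - b)\<^sup>2 + 2 * (b - c)\<^sup>2" for a b c :: real
proof -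
  have "2 * (a - b)\<^sup>2 + 2 * (b - c)\<^sup>2 - (a - c)\<^sup>2 = (a - 2 * b + c)\<^sup>2"
    by (simp add: power2_eq_square algebra_simps)
  thus ?thesis using zero_le_power2[of "a - 2 * b + c"] by linarith
qed

text \<open>
  The constant in the exponent is not optimal but suffices for the moment bound, and this version
  follows from the elementary bounds for the exponential on \<open>[0, 1]\<close>.
\<close>

lemma cosh_le_exp_square:
  fixes l :: real
  assumes "0 \<le> l" "l \<le> 1"
  shows "cosh l \<le> exp (l\<^sup>2)"
proof -
  have "exp (- l) \<le> 1 / (1 + l)"
    using exp_ge_add_one_self[of l] assms by (simp add: exp_minus field_simps)
  also have "\<dots> \<le> 1 - l + l\<^sup>2"
  proof -
    have "(1 - l + l\<^sup>2) * (1 + l) = 1 + l ^ 3"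
      by (simp add: algebra_simps power2_eq_square power3_eq_cube)
    thus ?thesis using assms by (simp add: divide_le_eq)
  qed
  finally have "cosh l \<le> 1 + l\<^sup>2"
    using exp_bound[OF assms] by (simp add: cosh_field_def)
  also have "\<dots> \<le> exp (l\<^sup>2)" by (rule exp_ge_add_one_self)
  finally show ?thesis .
qed

lemma sum_div2_le:
  fixes \<phi> :: "nat \<Rightarrow> real"
  assumes "\<And>n. 0 \<le> \<phi> n"
  shows "(\<Sum>m=2*a..<b. \<phi> (m div 2)) \<le> 2 * (\<Sum>m=a..<b. \<phi> m)"
proof -
  have "(\<Sum>m=2*a..<2*c. \<phi> (m div 2)) = 2 * (\<Sum>m=a..<c. \<phi> m)" for c
    by (induction c) (auto simp: atLeastLessThanSuc not_less_eq_eq)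
  moreover have "(\<Sum>m=2*a..<b. \<phi> (m div 2)) \<le> (\<Sum>m=2*a..<2*b. \<phi> (m div 2))"
    using assms by (intro sum_mono2) auto
  ultimately show ?thesis by simp
qed

lemma harm_le_ln: "1 \<le> n \<Longrightarrow> harm n \<le> 1 + ln (real n)"
  using decseqD[OF decseq_harm_diff_ln, of 0 "n - 1"] by (simp add: harm_def)

section \<open>Geometry of the wedge comb\<close>

locale wedge =
  fixes f :: "int \<Rightarrow> real"
  assumes f_nonneg: "0 \<le> f x"
    and f_even: "f (- x) = f x"
    and f_mono: "0 \<le> x \<Longrightarrow> x \<le> y \<Longrightarrow> f x \<le> f y"
begin

abbreviation N :: "int \<times> int \<Rightarrow> (int \<times> int) set" where
  "N \<equiv> neighbours (comb_edges f)"

abbreviation orig :: "int \<times> int" where "orig \<equiv> (0, 0)"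

lemma vert_iff: "(x, y) \<in> comb_verts f \<longleftrightarrow> real_of_int \<bar>y\<bar> \<le> f x"
  by (auto simp: comb_verts_def)

lemma spine_vert: "(x, 0) \<in> comb_verts f"
  using f_nonneg by (simp add: vert_iff)

lemma nbr_iff: "(x', y') \<in> N (x, y) \<longleftrightarrow> (x, y) \<in> comb_verts f \<and> (x', y') \<in> comb_verts f \<and>
   (x = x' \<and> \<bar>y - y'\<bar> = 1 \<or> y = 0 \<and> y' = 0 \<and> \<bar>x - x'\<bar> = 1)"
  unfolding neighbours_def comb_edges_def by (auto simp: doubleton_eq_iff)

lemma nbrs_subset: "N (x, y) \<subseteq> {(x + 1, y), (x - 1, y), (x, y + 1), (x, y - 1)}"
proof
  fix p assume "p \<in> N (x, y)"
  moreover obtain x' y' where "p = (x', y')" by (cases p)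
  ultimately show "p \<in> {(x + 1, y), (x - 1, y), (x, y + 1), (x, y - 1)}"
    by (auto simp: nbr_iff abs_if split: if_splits)
qed

sublocale undirected N
proof
  fix a b :: "int \<times> int"
  show "finite (N a)" using nbrs_subset[of "fst a" "snd a"] finite_subset by fastforce
  show "a \<in> N b" if "b \<in> N a"
    using that by (cases a; cases b) (auto simp: nbr_iff abs_minus_commute)
qed

lemma deg_le_4: "deg a \<le> 4"
proof -
  obtain x y where a: "a = (x, y)" by (cases a)
  have "card (N a) \<le> card {(x + 1, y), (x - 1, y), (x, y + 1), (x, y - 1)}"
    unfolding a by (rule card_mono[OF _ nbrs_subset]) simp
  also have "\<dots> \<le> 4"
    by (rule order_trans[OF card_insert_le_m1[of 4]]) (auto simp: card_insert_if)
  finally show ?thesis by simp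
qed

lemma nbrs_nonempty:
  assumes "a \<in> comb_verts f" shows "N a \<noteq> {}"
proof -
  obtain x y where a: "a = (x, y)" by (cases a)
  consider "y = 0" | "y > 0" | "y < 0" by linarith
  thus ?thesis
  proof cases
    case 1
    hence "(x + 1, 0) \<in> N a" by (simp add: a nbr_iff spine_vert)
    thus ?thesis by blast
  next
    case 2
    hence "(x, y - 1) \<in> N a" using assms by (auto simp: a nbr_iff vert_iff)
    thus ?thesis by blast
  next
    case 3
    hence "(x, y + 1) \<in> N a" using assms by (auto simp: a nbr_iff vert_iff)
    thus ?thesis by blast
  qed
qed

lemma nbrs_outside: "a \<notin> comb_verts f \<Longrightarrow> N a = {}"
  by (cases a) (auto simp: nbr_iff)

lemma deg_ge_1: "a \<in> comb_verts f \<Longrightarrow> 1 \<le> deg a"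
  using nbrs_nonempty[of a] finite_nbrs[of a] by (simp add: Suc_le_eq card_gt_0_iff)

lemma root_nbrs: "N orig \<noteq> {}"
  by (rule nbrs_nonempty[OF spine_vert])

text \<open>
  Descend the tooth, then move along the spine.
\<close>

lemma reaches_root:
  assumes "v \<in> comb_verts f"
  obtains d where "trans_prob N d v orig > 0"
proof -
  have step: "\<exists>d. trans_prob N d a orig > 0" if "b \<in> N a" "\<exists>d. trans_prob N d b orig > 0" for a b
  proof -
    from that obtain d where d: "trans_prob N d b orig > 0" by blast
    have "0 < (\<Sum>z\<in>N a. trans_prob N d z orig)"
      using that(1) d by (intro sum_pos2[OF finite_nbrs]) (auto simp: trans_prob_nonneg)
    moreover have "card (N a) > 0" using that(1) finite_nbrs[of a] by (auto simp: card_gt_0_iff)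
    ultimately have "trans_prob N (Suc d) a orig > 0" by (simp add: trans_prob_Suc avg_def)
    thus ?thesis by blast
  qed
  have spine: "\<exists>d. trans_prob N d (x, 0) orig > 0" for x
  proof (induction "nat \<bar>x\<bar>" arbitrary: x)
    case 0
    thus ?case by (intro exI[of _ 0]) (simp add: trans_prob_0)
  next
    case (Suc n)
    hence "n = nat \<bar>x - sgn x\<bar>" by (auto simp: sgn_if abs_if split: if_splits)
    moreover have "(x - sgn x, 0) \<in> N (x, 0)"
      using Suc.hyps(2) by (auto simp: nbr_iff spine_vert sgn_if)
    ultimately show ?case using Suc.hyps(1) step by blast
  qed
  have tooth: "\<exists>d. trans_prob N d (x, y) orig > 0" if "real_of_int \<bar>y\<bar> \<le> f x" for x y
    using that
  proof (induction "nat \<bar>y\<bar>" arbitrary: y)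
    case 0
    thus ?case using spine by simp
  next
    case (Suc n)
    hence "n = nat \<bar>y - sgn y\<bar>" "real_of_int \<bar>y - sgn y\<bar> \<le> f x"
      by (auto simp: sgn_if abs_if split: if_splits)
    moreover from this have "(x, y - sgn y) \<in> N (x, y)"
      using Suc.hyps(2) Suc.prems by (auto simp: nbr_iff vert_iff sgn_if)
    ultimately show ?case using Suc.hyps(1) step by blast
  qed
  show ?thesis using tooth[of "snd v" "fst v"] assms that by (cases v) (auto simp: vert_iff)
qed

lemma trans_prob_reflect: "trans_prob N n (- x, y) orig = trans_prob N n (x, y) orig"
proof -
  let ?\<phi> = "\<lambda>p :: int \<times> int. (- fst p, snd p)"
  have "N (?\<phi> a) = ?\<phi> ` N a" for a
  proof -
    obtain x y where a: "a = (x, y)" by (cases a)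
    have "(x', y') \<in> N (- x, y) \<longleftrightarrow> (- x', y') \<in> N (x, y)" for x' y'
      by (auto simp: nbr_iff vert_iff f_even abs_if)
    thus ?thesis unfolding a by (force simp: image_iff)
  qed
  moreover have "inj ?\<phi>" by (simp add: inj_def)
  ultimately have "trans_prob N n (?\<phi> (x, y)) (?\<phi> orig) = trans_prob N n (x, y) orig"
    by (intro trans_prob_automorphism)
  thus ?thesis by simp
qed

section \<open>Upper bounds along the spine and the teeth\<close>

text \<open>
  The function \<open>exp (- l * x)\<close> grows by a factor of at most \<open>cosh l\<close>
  under averaging, as only the two horizontal edges change \<open>x\<close>. It dominates the
  indicator of the root, hence the bound by iteration. It is good for times much smaller than
  \<open>x\<^sup>2\<close>.
\<close>

lemma trans_prob_exp_le:
  "trans_prob N n (x, y) orig \<le> exp (- l * of_int x) * cosh l ^ n"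
proof -
  let ?g = "\<lambda>p :: int \<times> int. exp (- l * of_int (fst p))"
  have c1: "cosh l \<ge> 1" by (rule cosh_real_ge_1)
  have "avg N ?g (x, y) \<le> cosh l * ?g (x, y)" for x y
  proof (cases "y = 0")
    case False
    have "avg N ?g (x, y) \<le> ?g (x, y)"
      using False by (intro avg_le_const) (auto simp: nbr_iff)
    also have "\<dots> \<le> cosh l * ?g (x, y)" using c1 by simp
    finally show ?thesis .
  next
    case True
    define W where "W = N (x, 0) - {(x + 1, 0), (x - 1, 0)}"
    have W: "z \<in> W \<Longrightarrow> fst z = x" for z
      unfolding W_def by (cases z) (auto simp: nbr_iff abs_if split: if_splits)
    have finW: "finite W" using finite_nbrs by (simp add: W_def)
    have N: "N (x, 0) = insert (x + 1, 0) (insert (x - 1, 0) W)"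
      unfolding W_def by (auto simp: nbr_iff spine_vert)
    have card: "card (N (x, 0)) = 2 + card W"
      unfolding N using finW by (simp add: W_def)
    have "(\<Sum>z\<in>W. ?g z) = card W * ?g (x, 0)"
      using sum.cong[of W W ?g "\<lambda>_. ?g (x, 0)"] W by simp
    hence "(\<Sum>z\<in>N (x, 0). ?g z) = ?g (x + 1, 0) + ?g (x - 1, 0) + card W * ?g (x, 0)"
      unfolding N using finW by (simp add: W_def)
    also have "?g (x + 1, 0) + ?g (x - 1, 0) = 2 * cosh l * ?g (x, 0)"
      by (simp add: cosh_def algebra_simps flip: exp_add)
    also have "2 * cosh l * ?g (x, 0) + card W * ?g (x, 0)
      \<le> 2 * cosh l * ?g (x, 0) + card W * (cosh l * ?g (x, 0))"
      using c1 by (intro add_left_mono mult_left_mono) auto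
    also have "\<dots> = real (card (N (x, 0))) * (cosh l * ?g (x, 0))"
      by (simp add: card algebra_simps)
    finally show ?thesis unfolding True avg_def card by (simp add: divide_le_eq mult_ac)
  qed
  hence step: "avg N ?g a \<le> cosh l * ?g a" for a by (cases a) auto
  have "trans_prob N n a orig \<le> ?g a * cosh l ^ n" for a
  proof (induction n arbitrary: a)
    case (Suc n)
    have "trans_prob N (Suc n) a orig \<le> avg N (\<lambda>z. cosh l ^ n * ?g z) a"
      unfolding trans_prob_Suc using Suc.IH by (intro avg_mono) (simp add: mult.commute)
    also have "\<dots> \<le> cosh l ^ n * (cosh l * ?g a)"
      unfolding avg_scale using c1 by (intro mult_left_mono step) auto
    finally show ?case by (simp add: mult_ac)
  qed (auto simp: trans_prob_0)
  from this[of "(x, y)"] show ?thesis by simp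
qed

text \<open>
  The expected number of collisions at \<open>(x, 0)\<close> before time \<open>T\<close> of two
  walks started at the root, up to the degree factors from reversibility.
\<close>

definition spine_sq :: "nat \<Rightarrow> int \<Rightarrow> real" where
  "spine_sq T x = (\<Sum>m<T. (trans_prob N m (x, 0) orig)\<^sup>2)"

lemma spine_sq_abs: "spine_sq T \<bar>x\<bar> = spine_sq T x"
  by (simp add: spine_sq_def abs_if trans_prob_reflect)

text \<open>
  To reach the root from beyond \<open>x\<close> the walk has to pass through \<open>(x,
  0)\<close>.
\<close>

lemma spine_sq_decreasing:
  assumes "0 \<le> x" "x \<le> x'" shows "spine_sq T x' \<le> spine_sq T x"
proof (cases "x = x'")
  case False
  show ?thesis unfolding spine_sq_def
    by (rule sum_squares_le_boundary[where R = "{p. x < fst p}" and N = N])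
       (use assms False in \<open>auto simp: nbr_iff trans_prob_0 trans_prob_Suc\<close>)
qed simp

text \<open>
  The tooth without its foot is attached to the rest of the comb only at the foot.
\<close>

lemma tooth_sq_le_spine_sq:
  "(\<Sum>m<T. (trans_prob N m (x, y) orig)\<^sup>2) \<le> spine_sq T x"
proof (cases "y = 0")
  case False
  show ?thesis unfolding spine_sq_def
    by (rule sum_squares_le_boundary[where R = "{p. fst p = x \<and> snd p \<noteq> 0}" and N = N])
       (use False in \<open>auto simp: nbr_iff trans_prob_0 trans_prob_Suc\<close>)
qed (simp add: spine_sq_def)

section \<open>Decay of the return probability\<close>

abbreviation w :: "nat \<Rightarrow> int \<Rightarrow> int \<Rightarrow> real" where "w n x y \<equiv> smooth orig n (x, y)"
abbreviation ret0 :: "nat \<Rightarrow> real" where "ret0 \<equiv> ret orig"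

text \<open>
  By \<open>energy_smooth\<close> this is an upper bound for the energy of \<open>w n\<close> on
  any set of edges.
\<close>

definition energy :: "nat \<Rightarrow> real" where
  "energy n = deg orig * (ret0 n - ret0 (Suc n))"

lemma energy_nonneg: "0 \<le> energy n"
  using ret_decreasing_Suc[OF root_nbrs, of n] by (simp add: energy_def)

lemma sum_energy_le: "(\<Sum>m=a..<b. energy m) \<le> deg orig * ret0 a"
proof (cases "a \<le> b")
  case True
  have "(\<Sum>m=a..<b. energy m) = deg orig * (ret0 a - ret0 b)"
    using True unfolding energy_def sum_distrib_left[symmetric]
    using sum_Suc_diff'[OF True, of "\<lambda>n. - ret0 n"] by simp
  also have "\<dots> \<le> deg orig * ret0 a" using ret_nonneg[of orig b] by (intro mult_left_mono) auto
  finally show ?thesis .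
qed (simp add: ret_nonneg)

lemma sum_energy_even_le: "(\<Sum>m=a..<b. energy (2 * m)) \<le> deg orig * ret0 (2 * a)"
proof -
  have "(\<Sum>m=a..<b. energy (2 * m)) = (\<Sum>m\<in>(\<lambda>m. 2 * m) ` {a..<b}. energy m)"
    by (subst sum.reindex) (auto simp: inj_on_def)
  also have "\<dots> \<le> (\<Sum>m=2*a..<2*b. energy m)"
    by (intro sum_mono2) (auto simp: energy_nonneg)
  also have "\<dots> \<le> deg orig * ret0 (2 * a)" by (rule sum_energy_le)
  finally show ?thesis .
qed

lemma spine_oscillation: "(w n 0 0 - w n (int x) 0)\<^sup>2 \<le> real x * energy n"
proof -
  let ?e = "\<lambda>i. ((int i, 0::int), (int (Suc i), 0::int))"
  have "(w n 0 0 - w n (int x) 0)\<^sup>2 \<le> real x * (\<Sum>i<x. (w n (int i) 0 - w n (int (Suc i)) 0)\<^sup>2)"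
    using telescope_square_le[of "\<lambda>i. w n (int i) 0" x] by simp
  also have "(\<Sum>i<x. (w n (int i) 0 - w n (int (Suc i)) 0)\<^sup>2)
    = (\<Sum>(a,z)\<in>?e ` {..<x}. (smooth orig n a - smooth orig n z)\<^sup>2)"
    by (subst sum.reindex) (auto simp: inj_on_def)
  also have "\<dots> \<le> energy n"
    unfolding energy_def by (rule energy_smooth) (auto simp: nbr_iff spine_vert)
  finally show ?thesis by (simp add: mult_left_mono)
qed

text \<open>
  Different teeth use different edges, so their energies add up to at most \<open>energy
  n\<close>. This is why averaging over many tall teeth costs less than a comparison along a
  single tooth.
\<close>

lemma teeth_oscillation:
  assumes "real h \<le> f (int r)"
  shows "(\<Sum>x=r..<2*r. \<Sum>y<h. (w n (int x) 0 - w n (int x) (int y))\<^sup>2) \<le> (real h)\<^sup>2 * energy n"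
proof -
  let ?d = "\<lambda>x i. (w n (int x) (int i) - w n (int x) (int (Suc i)))\<^sup>2"
  let ?e = "\<lambda>(x, i). ((int x, int i), (int x, int (Suc i)))"
  have vert: "(int x, int i) \<in> comb_verts f" if "r \<le> x" "i \<le> h" for x i
    using that assms f_mono[of "int r" "int x"] by (simp add: vert_iff)
  have "(\<Sum>y<h. (w n (int x) 0 - w n (int x) (int y))\<^sup>2) \<le> (\<Sum>y<h. real h * (\<Sum>i<h. ?d x i))" for x
  proof (rule sum_mono)
    fix y assume y: "y \<in> {..<h}"
    have "(w n (int x) 0 - w n (int x) (int y))\<^sup>2 \<le> real y * (\<Sum>i<y. ?d x i)"
      using telescope_square_le[of "\<lambda>i. w n (int x) (int i)" y] by simp
    also have "\<dots> \<le> real h * (\<Sum>i<h. ?d x i)"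
      using y by (intro mult_mono sum_mono2) (auto intro: sum_nonneg)
    finally show "(w n (int x) 0 - w n (int x) (int y))\<^sup>2 \<le> real h * (\<Sum>i<h. ?d x i)" .
  qed
  hence "(\<Sum>x=r..<2*r. \<Sum>y<h. (w n (int x) 0 - w n (int x) (int y))\<^sup>2)
    \<le> (\<Sum>x=r..<2*r. \<Sum>y<h. real h * (\<Sum>i<h. ?d x i))" by (rule sum_mono)
  also have "\<dots> = (real h)\<^sup>2 * (\<Sum>x=r..<2*r. \<Sum>i<h. ?d x i)"
    by (simp add: sum_distrib_left power2_eq_square mult.assoc)
  also have "(\<Sum>x=r..<2*r. \<Sum>i<h. ?d x i) = (\<Sum>p\<in>{r..<2*r} \<times> {..<h}. ?d (fst p) (snd p))"
    by (simp add: sum.cartesian_product case_prod_unfold)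
  also have "\<dots> = (\<Sum>(a,z)\<in>?e ` ({r..<2*r} \<times> {..<h}). (smooth orig n a - smooth orig n z)\<^sup>2)"
    by (subst sum.reindex) (auto simp: inj_on_def case_prod_unfold)
  also have "\<dots> \<le> energy n"
    unfolding energy_def
  proof (rule energy_smooth)
    fix a z assume "(a, z) \<in> ?e ` ({r..<2*r} \<times> {..<h})"
    then obtain x i where "a = (int x, int i)" "z = (int x, int (Suc i))" "r \<le> x" "i < h" by auto
    thus "z \<in> N a" using vert[of x i] vert[of x "Suc i"] by (simp add: nbr_iff)
  qed auto
  finally show ?thesis by (simp add: mult_left_mono)
qed

lemma rectangle_sq_le:
  assumes "real h \<le> f (int r)"
  shows "(\<Sum>x=r..<2*r. \<Sum>y<h. (w n (int x) (int y))\<^sup>2) \<le> 3 * deg orig * ret0 n"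
proof -
  let ?e = "\<lambda>(x, y). (int x, int y)"
  have "(\<Sum>x=r..<2*r. \<Sum>y<h. (w n (int x) (int y))\<^sup>2)
    = (\<Sum>a\<in>?e ` ({r..<2*r} \<times> {..<h}). (smooth orig n a)\<^sup>2)"
    by (subst sum.reindex) (auto simp: inj_on_def sum.cartesian_product case_prod_unfold)
  also have "\<dots> \<le> 3 * deg orig * ret0 n"
  proof (rule sum_smooth_squares[OF root_nbrs])
    fix a assume "a \<in> ?e ` ({r..<2*r} \<times> {..<h})"
    then obtain x y where "a = (int x, int y)" "r \<le> x" "y < h" by auto
    moreover have "f (int r) \<le> f (int x)" using \<open>r \<le> x\<close> by (intro f_mono) auto
    ultimately show "N a \<noteq> {}"
      using assms by (intro nbrs_nonempty) (simp add: vert_iff)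
  qed auto
  finally show ?thesis .
qed

text \<open>
  Write \<open>w 0 0\<close> as the value at a vertex of the rectangle with corners \<open>(r,
  0)\<close> and \<open>(2 * r, h)\<close> plus the difference, and average the squares over the
  rectangle. The values contribute their \<open>L\<^sup>2\<close> norm divided by the volume
  \<open>r * h\<close>, the differences contribute the energy times the resistance. The latter is
  of order \<open>r\<close>: after averaging over \<open>r\<close> teeth, their share is of order
  \<open>h / r\<close>, and \<open>h \<le> r\<^sup>2\<close>.
\<close>

lemma ret_square_le:
  assumes h: "1 \<le> r" "1 \<le> h" "real h \<le> f (int r)" "h \<le> r\<^sup>2"
  shows "(ret0 n)\<^sup>2 \<le> 6 * deg orig / (real r * real h) * ret0 n + 12 * real r * energy (2 * n)"
proof -
  let ?w = "w (2 * n)" and ?E = "energy (2 * n)"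
  have w0: "?w 0 0 = ret0 n" by (simp add: smooth_def ret_def)
  have hr: "(real h)\<^sup>2 \<le> (real r)\<^sup>2 * real h"
  proof -
    have "real h \<le> (real r)\<^sup>2" using h(4) by (metis of_nat_le_iff of_nat_power)
    thus ?thesis by (simp add: power2_eq_square[of "real h"] mult_right_mono)
  qed
  have "real r * real h * (ret0 n)\<^sup>2 = (\<Sum>x=r..<2*r. \<Sum>y<h. (?w 0 0)\<^sup>2)"
    by (simp add: w0)
  also have "\<dots> \<le> (\<Sum>x=r..<2*r. \<Sum>y<h. 2 * (?w (int x) (int y))\<^sup>2
      + (4 * (?w 0 0 - ?w (int x) 0)\<^sup>2 + 4 * (?w (int x) 0 - ?w (int x) (int y))\<^sup>2))"
  proof (intro sum_mono)
    fix x y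
    show "(?w 0 0)\<^sup>2 \<le> 2 * (?w (int x) (int y))\<^sup>2
      + (4 * (?w 0 0 - ?w (int x) 0)\<^sup>2 + 4 * (?w (int x) 0 - ?w (int x) (int y))\<^sup>2)"
      using square_le_double[of "?w 0 0" "?w (int x) (int y)"]
        diff_square_le_double[of "?w 0 0" "?w (int x) (int y)" "?w (int x) 0"]
      by (simp add: power2_commute[of "?w (int x) (int y)" "?w 0 0"])
  qed
  also have "\<dots> = 2 * (\<Sum>x=r..<2*r. \<Sum>y<h. (?w (int x) (int y))\<^sup>2)
      + (4 * (\<Sum>x=r..<2*r. \<Sum>y<h. (?w 0 0 - ?w (int x) 0)\<^sup>2)
      + 4 * (\<Sum>x=r..<2*r. \<Sum>y<h. (?w (int x) 0 - ?w (int x) (int y))\<^sup>2))"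
    by (simp only: sum.distrib sum_distrib_left)
  also have "\<dots> \<le> 2 * (3 * deg orig * ret0 (2 * n)) + (4 * (2 * (real r)\<^sup>2 * real h * ?E)
      + 4 * ((real h)\<^sup>2 * ?E))"
  proof (intro add_mono mult_left_mono)
    have "(\<Sum>x=r..<2*r. \<Sum>y<h. (?w 0 0 - ?w (int x) 0)\<^sup>2) \<le> (\<Sum>x=r..<2*r. \<Sum>y<h. real (2 * r) * ?E)"
      using energy_nonneg[of "2*n"]
      by (intro sum_mono order_trans[OF spine_oscillation] mult_right_mono) auto
    also have "\<dots> = 2 * (real r)\<^sup>2 * real h * ?E" by (simp add: power2_eq_square)
    finally show "(\<Sum>x=r..<2*r. \<Sum>y<h. (?w 0 0 - ?w (int x) 0)\<^sup>2) \<le> 2 * (real r)\<^sup>2 * real h * ?E" .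
  qed (use rectangle_sq_le[OF h(3)] teeth_oscillation[OF h(3)] in auto)
  also have "\<dots> \<le> 6 * deg orig * ret0 n + 12 * (real r)\<^sup>2 * real h * ?E"
  proof -
    have "ret0 (2 * n) \<le> ret0 n" by (rule ret_decreasing[OF root_nbrs]) simp
    hence "2 * (3 * deg orig * ret0 (2 * n)) \<le> 6 * deg orig * ret0 n"
      by (simp add: mult_left_mono)
    moreover have "(real h)\<^sup>2 * ?E \<le> (real r)\<^sup>2 * real h * ?E"
      using hr energy_nonneg by (rule mult_right_mono)
    ultimately show ?thesis by (simp add: algebra_simps)
  qed
  finally have "real r * real h * (ret0 n)\<^sup>2 \<le> 6 * deg orig * ret0 n + 12 * (real r)\<^sup>2 * real h * ?E" .
  hence "(ret0 n)\<^sup>2 \<le> (6 * deg orig * ret0 n + 12 * (real r)\<^sup>2 * real h * ?E) / (real r * real h)"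
    using h by (simp add: pos_le_divide_eq mult_ac)
  also have "\<dots> = 6 * deg orig / (real r * real h) * ret0 n + 12 * real r * ?E"
    using h by (simp add: field_simps power2_eq_square)
  finally show ?thesis .
qed

text \<open>
  As long as \<open>ret0\<close> exceeds a multiple of the reciprocal volume,
  \<open>ret_square_le\<close> bounds \<open>(ret0 j)\<^sup>2\<close> by \<open>r\<close> times a
  decrement of \<open>ret0\<close>, a discrete differential inequality. Summed over \<open>n \<le>
  j < 2 * n\<close> it yields \<open>n * ret0 (2 * n) = O(r)\<close>, and \<open>n = r\<^sup>2 *
  h\<close> is the time at which this is again the reciprocal volume.
\<close>

lemma ret_le:
  assumes h: "1 \<le> r" "1 \<le> h" "real h \<le> f (int r)" "h \<le> r\<^sup>2" and m: "2 * r\<^sup>2 * h \<le> m"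
  shows "ret0 m \<le> 24 * deg orig / (real r * real h)"
proof -
  define n where "n = r\<^sup>2 * h"
  define q where "q = deg orig"
  define K where "K = 6 * q / (real r * real h)"
  have pos: "real r > 0" "real h > 0" "q > 0" "n > 0" "K > 0"
    using h deg_ge_1[OF spine_vert[of 0]] by (auto simp: n_def q_def K_def)
  have "ret0 (2 * n) \<le> 4 * K"
  proof (rule ccontr)
    assume big: "\<not> ret0 (2 * n) \<le> 4 * K"
    have "(ret0 (2 * n))\<^sup>2 \<le> 16 * real r * energy (2 * j)" if "j \<in> {n..<2 * n}" for j
    proof -
      have le: "ret0 (2 * n) \<le> ret0 j" using that by (intro ret_decreasing[OF root_nbrs]) auto
      have "(ret0 j)\<^sup>2 \<le> K * ret0 j + 12 * real r * energy (2 * j)"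
        using ret_square_le[OF h, of j] by (simp add: K_def q_def)
      moreover have "4 * K * ret0 j \<le> ret0 j * ret0 j"
        using le big ret_nonneg[of orig j] by (intro mult_right_mono) auto
      moreover have "(ret0 (2 * n))\<^sup>2 \<le> (ret0 j)\<^sup>2" using le ret_nonneg by (intro power_mono) auto
      ultimately show ?thesis by (simp add: power2_eq_square)
    qed
    hence "(\<Sum>j=n..<2*n. (ret0 (2 * n))\<^sup>2) \<le> (\<Sum>j=n..<2*n. 16 * real r * energy (2 * j))"
      by (intro sum_mono)
    also have "\<dots> = 16 * real r * (\<Sum>j=n..<2*n. energy (2 * j))" by (simp add: sum_distrib_left)
    also have "\<dots> \<le> 16 * real r * (q * ret0 (2 * n))"
      unfolding q_def by (intro mult_left_mono sum_energy_even_le) auto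
    finally have "real n * ret0 (2 * n) * ret0 (2 * n) \<le> 16 * real r * q * ret0 (2 * n)"
      by (simp add: power2_eq_square mult_ac)
    hence "real n * ret0 (2 * n) \<le> 16 * real r * q"
      using big pos by (simp add: mult_le_cancel_right)
    hence "real r * (real r * real h * ret0 (2 * n)) \<le> real r * (16 * q)"
      by (simp add: n_def power2_eq_square mult_ac)
    hence "real r * real h * ret0 (2 * n) \<le> 16 * q" using pos by simp
    moreover have "real r * real h * (4 * K) < real r * real h * ret0 (2 * n)"
      using big pos by (intro mult_strict_left_mono) auto
    ultimately show False using pos by (simp add: K_def)
  qed
  moreover have "ret0 m \<le> ret0 (2 * n)"
    using m by (intro ret_decreasing[OF root_nbrs]) (simp add: n_def)
  ultimately show ?thesis by (simp add: K_def q_def)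
qed

end

section \<open>Walks meeting inside a tooth keep meeting\<close>

context wedge
begin

text \<open>
  The reciprocal height balances the number of further collisions that one collision brings about.
\<close>

definition weight :: "int \<times> int \<Rightarrow> real" where
  "weight a = 1 / real_of_int (max 1 \<bar>snd a\<bar>)"

lemma weight_pos: "0 < weight a"
  by (simp add: weight_def)

lemma avg_pow_one:
  assumes "a \<in> comb_verts f" shows "(avg N ^^ n) (\<lambda>z. indicator (comb_verts f) z) a = (1::real)"
  using assms
proof (induction n arbitrary: a)
  case (Suc n)
  have "N a \<subseteq> comb_verts f" by (cases a) (auto simp: nbr_iff)
  thus ?case using Suc nbrs_nonempty[OF Suc.prems] finite_nbrs[of a]
    by (auto intro!: avg_const simp: card_gt_0_iff)
qed simp

text \<open>
  The squared vertical displacement, frozen at the value \<open>y\<^sup>2\<close> off the half of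
  the tooth that contains \<open>y\<close>, increases by at most \<open>1\<close> under averaging:
  inside the tooth it increases by exactly \<open>1\<close>, at the tip the only step goes down,
  which is towards \<open>y\<close> unless \<open>y\<close> is the tip itself, and off the half
  tooth the values at the neighbours do not exceed \<open>y\<^sup>2\<close>. Its expectation after
  \<open>n \<le> t\<^sup>2\<close> steps is therefore at most \<open>t\<^sup>2\<close>, and
  Markov's inequality keeps the walk within distance \<open>2 * t\<close> with probability at
  least \<open>3 / 4\<close>.
\<close>

lemma tooth_confinement:
  fixes t :: nat
  assumes v: "(x, y) \<in> comb_verts f" and t: "4 * int t \<le> \<bar>y\<bar>" "1 \<le> t" and n: "n \<le> t\<^sup>2"
  defines "S \<equiv> (\<lambda>y'. (x, y')) ` {y - (2 * int t - 1)..y + (2 * int t - 1)}"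
  shows "3 / 4 \<le> (\<Sum>z\<in>S. trans_prob N n (x, y) z)"
proof -
  \<comment> \<open>The condition \<open>0 \<le> sgn y * y'\<close> describes the half of the tooth on the side of \<open>y\<close>.\<close>
  define \<psi> :: "int \<times> int \<Rightarrow> real" where
    "\<psi> = (\<lambda>(x', y'). of_int (if x' = x \<and> 0 \<le> sgn y * y' then (y' - y)\<^sup>2 else y\<^sup>2))"
  have y0: "y \<noteq> 0" using t by auto
  have far: "\<psi> z \<le> y\<^sup>2" if "fst z \<noteq> x \<or> snd z = 0 \<or> sgn y * snd z < 0 \<or> \<bar>snd z\<bar> = 1" for z
  proof -
    have "(y' - y)\<^sup>2 \<le> y\<^sup>2" if "\<bar>y'\<bar> = 1" "0 \<le> sgn y * y'" for y'
    proof -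
      have "\<bar>y' - y\<bar> \<le> \<bar>y\<bar>" using that y0 by (auto simp: sgn_if split: if_splits)
      thus ?thesis by (simp add: abs_le_square_iff)
    qed
    moreover obtain x' y' where "z = (x', y')" by (cases z)
    ultimately show ?thesis using that
      unfolding \<psi>_def by (auto simp del: of_int_power simp flip: of_int_power)
  qed
  have step: "avg N \<psi> a \<le> \<psi> a + 1" for a
  proof (cases "a \<in> comb_verts f")
    case False
    thus ?thesis by (auto simp: nbrs_outside avg_def \<psi>_def split: prod.splits)
  next
    case True
    obtain x' y' where a: "a = (x', y')" by (cases a)
    show ?thesis
    proof (cases "x' = x \<and> 0 < sgn y * y'")
      case False
      have "\<psi> a = y\<^sup>2" using False unfolding a \<psi>_def by (auto simp: order_less_le y0 sgn_0_0)
      moreover have "\<psi> z \<le> y\<^sup>2" if "z \<in> N a" for z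
      proof (rule far)
        obtain x'' y'' where z: "z = (x'', y'')" by (cases z)
        show "fst z \<noteq> x \<or> snd z = 0 \<or> sgn y * snd z < 0 \<or> \<bar>snd z\<bar> = 1"
          using that False y0 unfolding a z by (auto simp: nbr_iff sgn_if split: if_splits)
      qed
      ultimately have "\<psi> z \<le> \<psi> a + 1" if "z \<in> N a" for z
        using that by fastforce
      moreover have "0 \<le> \<psi> a" by (auto simp: \<psi>_def split: prod.splits)
      ultimately show ?thesis by (intro avg_le_const) auto
    next
      case up: True
      let ?s = "sgn y"
      have s: "?s = 1 \<or> ?s = -1" using y0 by (simp add: sgn_if)
      have x': "x' = x" using up by simp
      have down: "(x, y' - ?s) \<in> N a"
        using True up s unfolding a by (auto simp: nbr_iff vert_iff)
      have \<psi>a: "\<psi> a = of_int ((y' - y)\<^sup>2)" using up unfolding a \<psi>_def by auto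
      have \<psi>d: "\<psi> (x, y' - ?s) = of_int ((y' - ?s - y)\<^sup>2)"
        using up s unfolding \<psi>_def by auto
      have \<psi>u: "\<psi> (x, y' + ?s) = of_int ((y' + ?s - y)\<^sup>2)"
        using up s unfolding \<psi>_def by auto
      have sub: "N a \<subseteq> {(x, y' - ?s), (x, y' + ?s)}"
        using up s unfolding a by (auto simp: nbr_iff)
      show ?thesis
      proof (cases "(x, y' + ?s) \<in> N a")
        case True
        hence "N a = {(x, y' - ?s), (x, y' + ?s)}" using down sub by auto
        hence "avg N \<psi> a = (\<psi> (x, y' - ?s) + \<psi> (x, y' + ?s)) / 2"
          using s by (auto simp: avg_def)
        also have "\<dots> = \<psi> a + 1"
          unfolding \<psi>a \<psi>d \<psi>u using s by (auto simp: power2_eq_square field_simps)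
        finally show ?thesis by simp
      next
        case top: False
        hence Na: "N a = {(x, y' - ?s)}" using down sub by auto
        have "\<not> real_of_int \<bar>y' + ?s\<bar> \<le> f x"
          using top True up s unfolding a by (auto simp: nbr_iff vert_iff)
        hence "\<bar>y\<bar> < \<bar>y' + ?s\<bar>" using v by (simp add: vert_iff)
        hence ge: "\<bar>y\<bar> \<le> \<bar>y'\<bar>" using up s by auto
        have "avg N \<psi> a = of_int ((y' - ?s - y)\<^sup>2)" by (simp add: avg_def Na \<psi>d)
        also have "(y' - ?s - y)\<^sup>2 \<le> (y' - y)\<^sup>2 + 1"
          using ge up s by (auto simp: power2_eq_square algebra_simps sgn_if split: if_splits)
        finally show ?thesis unfolding \<psi>a by simp
      qed
    qed
  qed
  have mean: "(avg N ^^ n) \<psi> a \<le> \<psi> a + real n" for n a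
  proof (induction n arbitrary: a)
    case (Suc n)
    have "(avg N ^^ Suc n) \<psi> a \<le> avg N (\<lambda>z. \<psi> z + real n) a"
      using Suc by (auto intro: avg_mono)
    also have "\<dots> \<le> (\<psi> a + 1) + real n"
      unfolding avg_add by (intro add_mono step avg_le_const) auto
    finally show ?case by simp
  qed simp
  have t4: "0 < 4 * (real t)\<^sup>2" using t by simp
  have ind: "indicator (comb_verts f) z - 1 / (4 * (real t)\<^sup>2) * \<psi> z \<le> (indicator S z :: real)" for z
  proof (cases "z \<in> S")
    case True
    have "0 \<le> \<psi> z" by (auto simp: \<psi>_def split: prod.splits)
    hence "0 \<le> 1 / (4 * (real t)\<^sup>2) * \<psi> z" by simp
    moreover have "indicator (comb_verts f) z \<le> (1::real)" by (simp add: indicator_def)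
    ultimately have "indicator (comb_verts f) z - 1 / (4 * (real t)\<^sup>2) * \<psi> z \<le> 1" by linarith
    thus ?thesis using True by simp
  next
    case False
    obtain x' y' where z: "z = (x', y')" by (cases z)
    have "4 * (int t)\<^sup>2 \<le> (if x' = x \<and> 0 \<le> sgn y * y' then (y' - y)\<^sup>2 else y\<^sup>2)"
    proof -
      have "4 * (int t)\<^sup>2 = (2 * int t)\<^sup>2" by (simp add: power_mult_distrib)
      moreover have "(2 * int t)\<^sup>2 \<le> y\<^sup>2" using t by (subst abs_le_square_iff[symmetric]) linarith
      moreover have "(2 * int t)\<^sup>2 \<le> (y' - y)\<^sup>2" if "x' = x"
      proof -
        have "y' \<notin> {y - (2 * int t - 1)..y + (2 * int t - 1)}"
          using False that by (auto simp: S_def z)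
        thus ?thesis by (subst abs_le_square_iff[symmetric]) auto
      qed
      ultimately show ?thesis by auto
    qed
    hence "real_of_int (4 * (int t)\<^sup>2) \<le> \<psi> z" unfolding \<psi>_def z by (simp only: of_int_le_iff prod.case)
    hence "4 * (real t)\<^sup>2 \<le> \<psi> z" by simp
    hence "1 \<le> 1 / (4 * (real t)\<^sup>2) * \<psi> z" using t4 by (simp add: field_simps)
    moreover have "indicator (comb_verts f) z \<le> (1::real)" by (simp add: indicator_def)
    ultimately have "indicator (comb_verts f) z - 1 / (4 * (real t)\<^sup>2) * \<psi> z \<le> 0" by linarith
    thus ?thesis using False by simp
  qed
  have fin: "finite S" by (simp add: S_def)
  have "3 / 4 \<le> 1 - 1 / (4 * (real t)\<^sup>2) * real n"
  proof -
    have "real n \<le> (real t)\<^sup>2" using n by (metis of_nat_le_iff of_nat_power)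
    thus ?thesis using t4 by (simp add: field_simps)
  qed
  also have "\<dots> \<le> 1 - 1 / (4 * (real t)\<^sup>2) * (avg N ^^ n) \<psi> (x, y)"
  proof -
    have "\<psi> (x, y) = 0" using y0 by (auto simp: \<psi>_def sgn_if)
    hence "(avg N ^^ n) \<psi> (x, y) \<le> real n" using mean[of n "(x, y)"] by simp
    thus ?thesis using t4 by (intro diff_left_mono mult_left_mono) auto
  qed
  also have "\<dots> = (avg N ^^ n) (\<lambda>z. indicator (comb_verts f) z - 1 / (4 * (real t)\<^sup>2) * \<psi> z) (x, y)"
    by (simp only: avg_pow_diff avg_pow_scale avg_pow_one[OF v])
  also have "\<dots> \<le> (avg N ^^ n) (indicator S) (x, y)"
    by (rule avg_pow_mono[OF ind])
  also have "\<dots> = (\<Sum>z\<in>S. trans_prob N n (x, y) z)"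
    by (rule trans_prob_set[OF fin])
  finally show ?thesis .
qed

text \<open>
  At each of the first \<open>t\<^sup>2\<close> steps, with \<open>t\<close> about
  \<open>\<bar>y\<bar> / 4\<close>, the walk stays with probability at least \<open>3 / 4\<close>
  in a set of at most \<open>4 * t\<close> vertices, so by Cauchy-Schwarz two walks meet there
  with probability at least of order \<open>1 / t\<close>; the weight there is of order \<open>1 /
  t\<close> as well. For \<open>\<bar>y\<bar> < 4\<close> the meeting at time \<open>0\<close> is
  enough.
\<close>

lemma weighted_collisions_ge:
  assumes v: "a \<in> comb_verts f"
  shows "\<exists>M S. finite S \<and> 1 / 100 \<le> (\<Sum>m<M. \<Sum>z\<in>S. (trans_prob N m a z)\<^sup>2 * weight z)"
proof -
  obtain x y where a: "a = (x, y)" by (cases a)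
  show ?thesis
  proof (cases "\<bar>y\<bar> < 4")
    case True
    have "1 / 100 \<le> weight a" using True by (auto simp: weight_def a max_def divide_simps)
    hence "finite {a} \<and> 1 / 100 \<le> (\<Sum>m<1. \<Sum>z\<in>{a}. (trans_prob N m a z)\<^sup>2 * weight z)"
      by (simp add: trans_prob_0)
    thus ?thesis by blast
  next
    case False
    define t where "t = nat (\<bar>y\<bar> div 4)"
    have t: "4 * int t \<le> \<bar>y\<bar>" "1 \<le> t" "\<bar>y\<bar> \<le> 8 * int t"
    proof -
      have "4 * (\<bar>y\<bar> div 4) \<le> \<bar>y\<bar>" "\<bar>y\<bar> < 4 * (\<bar>y\<bar> div 4) + 4" by presburger+
      moreover from this have "1 \<le> \<bar>y\<bar> div 4" using False by linarith
      moreover from this have "int t = \<bar>y\<bar> div 4" by (simp add: t_def)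
      ultimately show "4 * int t \<le> \<bar>y\<bar>" "1 \<le> t" "\<bar>y\<bar> \<le> 8 * int t" by linarith+
    qed
    define S where "S = (\<lambda>y'. (x, y')) ` {y - (2 * int t - 1)..y + (2 * int t - 1)}"
    have fin: "finite S" by (simp add: S_def)
    have card: "real (card S) \<le> 4 * real t"
      using t by (simp add: S_def card_image inj_on_def)
    have wt: "1 / (10 * real t) \<le> weight z" if "z \<in> S" for z
    proof -
      have "max 1 \<bar>snd z\<bar> \<le> 10 * int t" using that t by (auto simp: S_def)
      hence "real_of_int (max 1 \<bar>snd z\<bar>) \<le> real_of_int (10 * int t)" by (simp only: of_int_le_iff)
      thus ?thesis unfolding weight_def using t(2) by (intro divide_left_mono) (auto simp: max_def)
    qed
    have "9 / 64 / real t * (1 / (10 * real t)) \<le> (\<Sum>z\<in>S. (trans_prob N m a z)\<^sup>2 * weight z)"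
      if "m < Suc (t\<^sup>2)" for m
    proof -
      have "3 / 4 \<le> (\<Sum>z\<in>S. trans_prob N m a z)"
        unfolding S_def a using v that t by (intro tooth_confinement) (auto simp: a)
      hence "(3 / 4)\<^sup>2 \<le> (\<Sum>z\<in>S. trans_prob N m a z * 1)\<^sup>2" by (intro power_mono) auto
      also have "\<dots> \<le> (\<Sum>z\<in>S. (trans_prob N m a z)\<^sup>2) * (\<Sum>z\<in>S. 1\<^sup>2)"
        by (rule Cauchy_Schwarz_ineq_sum)
      also have "\<dots> \<le> (\<Sum>z\<in>S. (trans_prob N m a z)\<^sup>2) * (4 * real t)"
        using card by (intro mult_left_mono sum_nonneg) auto
      finally have "9 / 64 / real t \<le> (\<Sum>z\<in>S. (trans_prob N m a z)\<^sup>2)"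
        using t by (simp add: field_simps power2_eq_square)
      hence "9 / 64 / real t * (1 / (10 * real t)) \<le> (\<Sum>z\<in>S. (trans_prob N m a z)\<^sup>2) * (1 / (10 * real t))"
        by (rule mult_right_mono) simp
      also have "\<dots> \<le> (\<Sum>z\<in>S. (trans_prob N m a z)\<^sup>2 * weight z)"
        unfolding sum_distrib_right using wt by (intro sum_mono mult_left_mono) auto
      finally show ?thesis .
    qed
    hence "(\<Sum>m<Suc (t\<^sup>2). 9 / 64 / real t * (1 / (10 * real t)))
      \<le> (\<Sum>m<Suc (t\<^sup>2). \<Sum>z\<in>S. (trans_prob N m a z)\<^sup>2 * weight z)"
      by (intro sum_mono) auto
    moreover have "1 / 100 \<le> (\<Sum>m<Suc (t\<^sup>2). 9 / 64 / real t * (1 / (10 * real t)))"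
      using t by (simp add: field_simps power2_eq_square)
    ultimately have "1 / 100 \<le> (\<Sum>m<Suc (t\<^sup>2). \<Sum>z\<in>S. (trans_prob N m a z)\<^sup>2 * weight z)"
      by linarith
    thus ?thesis using fin by blast
  qed
qed

end

section \<open>Collisions on the spine at geometric scales\<close>

text \<open>
  Everything is done at the scales \<open>32 ^ s\<close>; monotonicity fills the gaps. The scale
  \<open>8 ^ s\<close>, which is the scale \<open>32 ^ s\<close> to the power \<open>3 /
  5\<close>, and the growth rate \<open>45\<close> are tied together by \<open>32 < 45\<close>,
  \<open>45\<^sup>2 < 32 * 8\<^sup>2\<close> and \<open>8\<^sup>3 < 32\<^sup>2\<close>: the
  profile may grow slightly faster than linearly, the return probability at time \<open>8 ^ (3 *
  s)\<close> is small enough for the energy term over a tooth of height of order \<open>45 ^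
  s\<close>, and by that time the walk is unlikely to have reached distance \<open>32 ^ s\<close>.
  The base \<open>32\<close> keeps all these scales powers of integers.
\<close>

locale growing_wedge = wedge +
  fixes s0 :: nat and D C0 :: real
  assumes height_le: "s0 \<le> s \<Longrightarrow> f (32 ^ s) \<le> 1024 ^ s"
    and height_ge: "s0 \<le> s \<Longrightarrow> 8 ^ s \<le> f (8 ^ s)"
    and height_pos: "s0 \<le> s \<Longrightarrow> 1 \<le> f (32 ^ s)"
    and height_growth: "s0 \<le> s \<Longrightarrow> 32 * f (32 ^ s) \<le> f (32 ^ Suc s)"
    and height_doubling: "s0 \<le> s \<Longrightarrow> f (32 ^ Suc s) \<le> D * f (32 ^ s)"
    and height_poly: "s0 \<le> s \<Longrightarrow> f (32 ^ s) \<le> C0 * 45 ^ s"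
begin

definition hgt :: "nat \<Rightarrow> nat" where "hgt s = nat \<lfloor>f (32 ^ s)\<rfloor>"
text \<open>
  The relaxation time of the part of the comb up to distance \<open>32 ^ s\<close>: from this time
  on, \<open>ret_le\<close> applies to the rectangle of width \<open>32 ^ s\<close> and height
  \<open>hgt s\<close>.
\<close>

definition \<tau> :: "nat \<Rightarrow> nat" where "\<tau> s = 2 * 1024 ^ s * hgt s"
definition \<kappa> :: real where "\<kappa> = 24 * deg orig"

lemma hgt_le: "real (hgt s) \<le> f (32 ^ s)"
  using f_nonneg[of "32 ^ s"] by (simp add: hgt_def)

lemma hgt_gt: "f (32 ^ s) < real (hgt s) + 1"
  unfolding hgt_def using f_nonneg[of "32 ^ s"] by linarith

lemma hgt_pos: assumes "s0 \<le> s" shows "1 \<le> hgt s"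
  using height_pos[OF assms] by (simp add: hgt_def le_nat_iff le_floor_iff)

lemma hgt_le_1024: assumes "s0 \<le> s" shows "hgt s \<le> (32 ^ s)\<^sup>2"
proof -
  have "real (hgt s) \<le> 1024 ^ s" using hgt_le height_le[OF assms] order_trans by blast
  also have "\<dots> = real ((32 ^ s)\<^sup>2)" by (simp add: power2_eq_square flip: power_mult_distrib)
  finally show ?thesis by linarith
qed

lemma hgt_growth: assumes "s0 \<le> s" shows "32 * hgt s \<le> hgt (Suc s)"
proof -
  have "real (32 * hgt s) \<le> f (32 ^ Suc s)" using hgt_le[of s] height_growth[OF assms] by simp
  thus ?thesis unfolding hgt_def[of "Suc s"] by linarith
qed

lemma D_pos: "0 < D"
proof -
  have "0 < D * f (32 ^ s0)"
    using height_doubling[of s0] height_growth[of s0] height_pos[of s0] by simp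
  thus ?thesis using height_pos[of s0] by (simp add: zero_less_mult_iff)
qed

lemma hgt_doubling: assumes "s0 \<le> s" shows "real (hgt (Suc s)) \<le> 2 * D * real (hgt s)"
proof -
  have "real (hgt (Suc s)) \<le> D * f (32 ^ s)" using hgt_le[of "Suc s"] height_doubling[OF assms] by simp
  also have "\<dots> \<le> D * (2 * real (hgt s))"
    using D_pos hgt_gt[of s] hgt_pos[OF assms] by (intro mult_left_mono) auto
  finally show ?thesis by simp
qed

lemma hgt_poly: "s0 \<le> s \<Longrightarrow> real (hgt s) \<le> C0 * 45 ^ s"
  using hgt_le height_poly order_trans by blast

lemma C0_pos: "0 < C0"
proof -
  have "0 < C0 * 45 ^ s0" using height_poly[of s0] height_pos[of s0] by simp
  thus ?thesis by (simp add: zero_less_mult_iff)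
qed

lemma \<kappa>_pos: "0 < \<kappa>"
  using deg_ge_1[OF spine_vert[of 0]] by (simp add: \<kappa>_def)

lemma ret_le_\<tau>:
  assumes s: "s0 \<le> s" and m: "\<tau> s \<le> m"
  shows "ret0 m \<le> \<kappa> / (32 ^ s * real (hgt s))"
proof -
  have "2 * (32 ^ s)\<^sup>2 * hgt s \<le> m"
    using m by (simp add: \<tau>_def power2_eq_square power_mult_distrib[symmetric])
  thus ?thesis
    using ret_le[of "32 ^ s" "hgt s" m] hgt_pos[OF s] hgt_le_1024[OF s] hgt_le[of s] by (simp add: \<kappa>_def)
qed

text \<open>
  The same estimate for a square of side \<open>8 ^ s\<close>, whose relaxation time is far below
  \<open>\<tau> s\<close>.
\<close>

lemma ret_le_early:
  assumes s: "s0 \<le> s" and m: "2 * 512 ^ s \<le> m"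
  shows "ret0 m \<le> \<kappa> / 64 ^ s"
proof -
  have "2 * (8 ^ s)\<^sup>2 * 8 ^ s \<le> m"
    using m by (simp add: power2_eq_square power_mult_distrib[symmetric] mult.assoc)
  moreover have "(8::nat) ^ s \<le> (8 ^ s)\<^sup>2" by (simp add: power2_eq_square)
  ultimately have "ret0 m \<le> \<kappa> / (8 ^ s * 8 ^ s)"
    using ret_le[of "8 ^ s" "8 ^ s" m] height_ge[OF s] by (simp add: \<kappa>_def)
  thus ?thesis by (simp flip: power_mult_distrib)
qed

lemma \<tau>_Suc: assumes "s0 \<le> s" shows "real (\<tau> (Suc s)) \<le> 4096 * D * 1024 ^ s * real (hgt s)"
  using mult_left_mono[OF hgt_doubling[OF assms], of "2048 * 1024 ^ s"] by (simp add: \<tau>_def mult_ac)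

lemma \<tau>_Suc_ge: assumes "s0 \<le> s" shows "2 * \<tau> s \<le> \<tau> (Suc s)"
proof -
  have "2 * 1024 ^ s * (2 * hgt s) \<le> 2 * (1024 * 1024 ^ s) * hgt (Suc s)"
    using hgt_growth[OF assms] by (intro mult_mono) auto
  thus ?thesis by (simp add: \<tau>_def mult_ac)
qed

lemma \<tau>_mono:
  assumes "s0 \<le> s" "s \<le> t" shows "\<tau> s \<le> \<tau> t"
  using assms(2)
proof (induction t rule: dec_induct)
  case (step t)
  thus ?case using \<tau>_Suc_ge[of t] assms(1) by simp
qed simp

lemma \<tau>_ge: assumes "s0 \<le> s" shows "s \<le> \<tau> s"
proof -
  have "s \<le> 1024 ^ s" by (rule less_imp_le, rule less_exp[THEN less_le_trans]) (simp add: power_mono)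
  also have "\<dots> \<le> \<tau> s" using hgt_pos[OF assms] by (simp add: \<tau>_def)
  finally show ?thesis .
qed

lemma sum_ret_block:
  assumes s: "s0 \<le> s"
  shows "(\<Sum>m=\<tau> s..<\<tau> (Suc s). ret0 m) \<le> 4096 * D * \<kappa> * 32 ^ s"
    and "(\<Sum>m=\<tau> s..<\<tau> (Suc s). (ret0 m)\<^sup>2) \<le> 4096 * D * \<kappa>\<^sup>2 / real (hgt s)"
proof -
  let ?b = "\<kappa> / (32 ^ s * real (hgt s))"
  have gp: "real (hgt s) > 0" using hgt_pos[OF s] by simp
  have b: "0 \<le> ?b" using \<kappa>_pos by simp
  have c: "real (card {\<tau> s..<\<tau> (Suc s)}) \<le> 4096 * D * 1024 ^ s * real (hgt s)"
    using \<tau>_Suc[OF s] by simp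
  have p: "(1024::real) ^ s = 32 ^ s * 32 ^ s" by (simp flip: power_mult_distrib)
  have "(\<Sum>m=\<tau> s..<\<tau> (Suc s). ret0 m) \<le> real (card {\<tau> s..<\<tau> (Suc s)}) * ?b"
    using ret_le_\<tau>[OF s] by (intro sum_bounded_above) auto
  also have "\<dots> \<le> 4096 * D * 1024 ^ s * real (hgt s) * ?b" using c b by (rule mult_right_mono)
  also have "\<dots> = 4096 * D * \<kappa> * 32 ^ s" using gp by (simp add: p)
  finally show "(\<Sum>m=\<tau> s..<\<tau> (Suc s). ret0 m) \<le> 4096 * D * \<kappa> * 32 ^ s" .
  have "(\<Sum>m=\<tau> s..<\<tau> (Suc s). (ret0 m)\<^sup>2) \<le> real (card {\<tau> s..<\<tau> (Suc s)}) * ?b\<^sup>2"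
    using ret_le_\<tau>[OF s] ret_nonneg by (intro sum_bounded_above power_mono) auto
  also have "\<dots> \<le> 4096 * D * 1024 ^ s * real (hgt s) * ?b\<^sup>2" using c by (rule mult_right_mono) simp
  also have "\<dots> = 4096 * D * \<kappa>\<^sup>2 / real (hgt s)"
    using gp by (simp add: p power2_eq_square)
  finally show "(\<Sum>m=\<tau> s..<\<tau> (Suc s). (ret0 m)\<^sup>2) \<le> 4096 * D * \<kappa>\<^sup>2 / real (hgt s)" .
qed

text \<open>
  The Green function at the root up to the relaxation time is at most of the order of the
  resistance \<open>32 ^ s\<close>. The contributions of the blocks between consecutive
  \<open>\<tau> s\<close> form a geometric series.
\<close>

lemma sum_ret_le: "\<exists>C\<ge>0. \<forall>s\<ge>s0. (\<Sum>m<\<tau> s. ret0 m) \<le> C * 32 ^ s"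
proof -
  define C where "C = (\<Sum>m<\<tau> s0. ret0 m) + 4096 * D * \<kappa>"
  have pos: "0 \<le> 4096 * D * \<kappa>" "0 \<le> (\<Sum>m<\<tau> s0. ret0 m)"
    using D_pos \<kappa>_pos by (auto intro: sum_nonneg ret_nonneg)
  have "(\<Sum>m<\<tau> s. ret0 m) \<le> C * 32 ^ s" if "s0 \<le> s" for s
    using that
  proof (induction s rule: dec_induct)
    case base
    have "(\<Sum>m<\<tau> s0. ret0 m) * 1 \<le> C * 32 ^ s0"
      using pos unfolding C_def by (intro mult_mono) auto
    thus ?case by simp
  next
    case (step s)
    have "\<tau> s \<le> \<tau> (Suc s)" using \<tau>_Suc_ge[OF step.hyps(1)] by simp
    hence "(\<Sum>m<\<tau> (Suc s). ret0 m) = (\<Sum>m<\<tau> s. ret0 m) + (\<Sum>m=\<tau> s..<\<tau> (Suc s). ret0 m)"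
      by (simp add: lessThan_atLeast0 sum.atLeastLessThan_concat)
    also have "\<dots> \<le> C * 32 ^ s + C * 32 ^ s"
    proof (intro add_mono step.IH)
      have "4096 * D * \<kappa> * 32 ^ s \<le> C * 32 ^ s"
        using pos by (intro mult_right_mono) (auto simp: C_def)
      thus "(\<Sum>m=\<tau> s..<\<tau> (Suc s). ret0 m) \<le> C * 32 ^ s"
        using sum_ret_block(1)[OF step.hyps(1)] by linarith
    qed
    also have "\<dots> \<le> C * 32 ^ Suc s" using pos by (simp add: C_def)
    finally show ?case .
  qed
  thus ?thesis using pos by (intro exI[of _ C]) (auto simp: C_def)
qed

text \<open>
  Here the blocks decrease geometrically, so that the first one decides.
\<close>

lemma sum_ret_sq_le:
  assumes s: "s0 \<le> s"
  shows "(\<Sum>m=\<tau> s..<T. (ret0 m)\<^sup>2) \<le> 8192 * D * \<kappa>\<^sup>2 / real (hgt s)"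
proof -
  define B where "B = 4096 * D * \<kappa>\<^sup>2"
  have B: "0 \<le> B" using D_pos by (simp add: B_def)
  \<comment> \<open>By induction the tail after the first block is at most \<open>2 * B / (32 * hgt s)\<close>, so the factor
    \<open>2\<close> reproduces itself.\<close>
  have main: "(\<Sum>m=\<tau> s..<\<tau> (s + k). (ret0 m)\<^sup>2) \<le> 2 * B / real (hgt s)" if "s0 \<le> s" for s k
    using that
  proof (induction k arbitrary: s)
    case (Suc k)
    have gp: "real (hgt s) > 0" using hgt_pos[OF Suc.prems] by simp
    have mono: "\<tau> s \<le> \<tau> (Suc s)" using \<tau>_mono[OF Suc.prems, of "Suc s"] by simp
    have le: "\<tau> (Suc s) \<le> \<tau> (s + Suc k)" using Suc.prems by (intro \<tau>_mono) auto
    have "(\<Sum>m=\<tau> s..<\<tau> (s + Suc k). (ret0 m)\<^sup>2)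
      = (\<Sum>m=\<tau> s..<\<tau> (Suc s). (ret0 m)\<^sup>2) + (\<Sum>m=\<tau> (Suc s)..<\<tau> (Suc s + k). (ret0 m)\<^sup>2)"
      using mono le by (simp add: sum.atLeastLessThan_concat)
    also have "\<dots> \<le> B / real (hgt s) + 2 * B / real (hgt (Suc s))"
      using sum_ret_block(2)[OF Suc.prems] Suc.IH[of "Suc s"] Suc.prems
      by (intro add_mono) (auto simp: B_def)
    also have "2 * B / real (hgt (Suc s)) \<le> 2 * B / (32 * real (hgt s))"
      using hgt_growth[OF Suc.prems] gp B by (intro divide_left_mono) (auto simp: mult_pos_pos)
    also have "B / real (hgt s) + 2 * B / (32 * real (hgt s)) \<le> 2 * B / real (hgt s)"
      using gp B by (simp add: field_simps)
    finally show ?case by simp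
  qed (use B in auto)
  have "T \<le> \<tau> (s + T)" using \<tau>_ge[of "s + T"] s by simp
  hence "(\<Sum>m=\<tau> s..<T. (ret0 m)\<^sup>2) \<le> (\<Sum>m=\<tau> s..<\<tau> (s + T). (ret0 m)\<^sup>2)"
    by (intro sum_mono2) auto
  also have "\<dots> \<le> 2 * B / real (hgt s)" by (rule main[OF s])
  finally show ?thesis by (simp add: B_def)
qed

text \<open>
  The resistance between the root and \<open>(32 ^ s, 0)\<close> is \<open>32 ^ s\<close>, and the
  total energy dissipated after time \<open>2 * \<tau> s\<close> is at most of order \<open>ret0
  (\<tau> s)\<close>, that is \<open>1 / (32 ^ s * hgt s)\<close>. So the squared difference of
  the heat kernels at the two vertices, summed over all later times, is \<open>O(1 / hgt
  s)\<close>. The kernel at the root is controlled by \<open>sum_ret_sq_le\<close>.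
\<close>

lemma late_spine_sq_le:
  assumes s: "s0 \<le> s"
  shows "(\<Sum>m=2*\<tau> s..<T. (trans_prob N m (32 ^ s, 0) orig)\<^sup>2) \<le> (131072 * D * \<kappa>\<^sup>2 + \<kappa>\<^sup>2) / real (hgt s)"
proof -
  have "(\<Sum>m=2*\<tau> s..<T. (trans_prob N m (32 ^ s, 0) orig)\<^sup>2)
    \<le> (\<Sum>m=2*\<tau> s..<T. 8 * (ret0 (m div 2))\<^sup>2 + 2 * 32 ^ s * energy m)"
  proof (rule sum_mono)
    fix m
    have "(trans_prob N m (32 ^ s, 0) orig)\<^sup>2 \<le> (w m (32 ^ s) 0)\<^sup>2"
      using trans_prob_le_smooth trans_prob_nonneg by (intro power_mono) auto
    also have "\<dots> \<le> 2 * (w m 0 0)\<^sup>2 + 2 * (w m 0 0 - w m (32 ^ s) 0)\<^sup>2" by (rule square_le_double)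
    also have "\<dots> \<le> 2 * (2 * ret0 (m div 2))\<^sup>2 + 2 * (32 ^ s * energy m)"
      using spine_oscillation[of m "32 ^ s"] smooth_root[OF root_nbrs, of m] smooth_nonneg
      by (intro add_mono mult_left_mono power_mono) auto
    finally show "(trans_prob N m (32 ^ s, 0) orig)\<^sup>2 \<le> 8 * (ret0 (m div 2))\<^sup>2 + 2 * 32 ^ s * energy m"
      by (simp add: power_mult_distrib)
  qed
  also have "\<dots> = 8 * (\<Sum>m=2*\<tau> s..<T. (ret0 (m div 2))\<^sup>2) + 2 * 32 ^ s * (\<Sum>m=2*\<tau> s..<T. energy m)"
    by (simp add: sum.distrib sum_distrib_left)
  also have "\<dots> \<le> 8 * (2 * (8192 * D * \<kappa>\<^sup>2 / real (hgt s))) + 2 * 32 ^ s * (deg orig * (\<kappa> / (32 ^ s * real (hgt s))))"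
  proof (intro add_mono mult_left_mono)
    show "(\<Sum>m=2*\<tau> s..<T. (ret0 (m div 2))\<^sup>2) \<le> 2 * (8192 * D * \<kappa>\<^sup>2 / real (hgt s))"
      using sum_div2_le[of "\<lambda>m. (ret0 m)\<^sup>2" "\<tau> s" T] sum_ret_sq_le[OF s, of T] by simp
    show "(\<Sum>m=2*\<tau> s..<T. energy m) \<le> deg orig * (\<kappa> / (32 ^ s * real (hgt s)))"
      by (rule order_trans[OF sum_energy_le mult_left_mono[OF ret_le_\<tau>[OF s]]]) auto
  qed auto
  also have "\<dots> = (131072 * D * \<kappa>\<^sup>2 + 2 * deg orig * \<kappa>) / real (hgt s)"
    by (simp add: add_divide_distrib)
  also have "\<dots> \<le> (131072 * D * \<kappa>\<^sup>2 + \<kappa>\<^sup>2) / real (hgt s)"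
    by (intro divide_right_mono) (simp_all add: \<kappa>_def power2_eq_square)
  finally show ?thesis .
qed

text \<open>
  The choice \<open>l = 1 / 24 ^ s\<close> lies between the two constraints: \<open>l\<^sup>2 *
  512 ^ s \<le> 1\<close>, since \<open>24\<^sup>2 > 512\<close>, and \<open>l * 32 ^ s\<close>
  grows exponentially in \<open>s\<close>.
\<close>

lemma early_trans_prob_le:
  assumes m: "m < 2 * 512 ^ s" and x: "32 ^ t \<le> x" and s: "s = Suc t"
  shows "trans_prob N m (x, 0) orig \<le> exp (2 - (4 / 3) ^ s / 32)"
proof -
  define l :: real where "l = 1 / 24 ^ s"
  have l: "0 \<le> l" "l \<le> 1" by (auto simp: l_def)
  have "trans_prob N m (x, 0) orig \<le> exp (- l * of_int x) * cosh l ^ m" by (rule trans_prob_exp_le)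
  also have "\<dots> \<le> exp (- ((4 / 3) ^ s / 32)) * exp 2"
  proof (intro mult_mono)
    have "(4 / 3 :: real) ^ s = (32 / 24) ^ s" by simp
    also have "\<dots> = 32 ^ s * l" unfolding l_def power_divide by simp
    finally have "(4 / 3) ^ s / 32 = l * 32 ^ t" by (simp add: s)
    also have "\<dots> \<le> l * of_int x"
    proof -
      have "real_of_int (32 ^ t) \<le> real_of_int x" using x by (simp only: of_int_le_iff)
      thus ?thesis using l by (intro mult_left_mono) auto
    qed
    finally show "exp (- l * of_int x) \<le> exp (- ((4 / 3) ^ s / 32))" by simp
    have "cosh l ^ m \<le> exp (l\<^sup>2) ^ m"
      using cosh_le_exp_square[OF l] by (intro power_mono) auto
    also have "\<dots> = exp (real m * l\<^sup>2)" by (simp add: exp_of_nat_mult)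
    also have "real m * l\<^sup>2 \<le> 2 * 512 ^ s * (1 / 576 ^ s)"
    proof (intro mult_mono)
      have "real m < real (2 * 512 ^ s)" using m by (simp only: of_nat_less_iff)
      thus "real m \<le> 2 * 512 ^ s" by simp
      show "l\<^sup>2 \<le> 1 / 576 ^ s" by (simp add: l_def power2_eq_square flip: power_mult_distrib)
    qed auto
    also have "\<dots> \<le> 2" by (simp add: divide_le_eq power_mono)
    finally show "cosh l ^ m \<le> exp 2" by simp
  qed auto
  also have "\<dots> = exp (2 - (4 / 3) ^ s / 32)" by (simp flip: exp_add)
  finally show ?thesis .
qed

text \<open>
  The number of early times, the square of the bound from \<open>early_trans_prob_le\<close>, and
  the growth rate of \<open>hgt s\<close>.
\<close>

lemma eventually_early_small:
  "\<forall>\<^sub>F s in sequentially. 2 * 512 ^ s * (exp (2 - (4 / 3) ^ s / 32))\<^sup>2 * 45 ^ s \<le> (1::real)"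
  by real_asymp

text \<open>
  Before the relaxation time the heat kernel at distance \<open>32 ^ s\<close> is much smaller
  than at the root, so a comparison with the root loses too much; the \<open>L\<^sup>2\<close>
  norm of the kernel is used instead. The sum at \<open>32 ^ s\<close> is at most the sum at every
  spine vertex of the rectangle one scale below. There the foot of a tooth is compared with the
  vertices of the tooth. The sum over the rectangle of the squares at time \<open>m\<close> is
  \<open>O(ret0 m)\<close>, and \<open>sum_ret_le\<close> bounds the total by \<open>O(32 ^
  s)\<close>; division by the volume \<open>32 ^ t * hgt t\<close> leaves \<open>O(1 / hgt
  t)\<close>. The energy term in the comparison is small enough from time \<open>2 * 512 ^
  s\<close> on, and earlier times are covered by \<open>early_trans_prob_le\<close>.
\<close>

lemma early_spine_sq_le:
  "\<exists>C\<ge>0. \<exists>s1\<ge>s0. \<forall>s\<ge>s1. spine_sq (2 * \<tau> s) (32 ^ s) \<le> C / real (hgt s)"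
proof -
  obtain C where C: "0 \<le> C" "\<And>s. s0 \<le> s \<Longrightarrow> (\<Sum>m<\<tau> s. ret0 m) \<le> C * 32 ^ s"
    using sum_ret_le by blast
  obtain s2 where s2: "\<And>s. s2 \<le> s \<Longrightarrow> 2 * 512 ^ s * (exp (2 - (4 / 3) ^ s / 32))\<^sup>2 * 45 ^ s \<le> (1::real)"
    using eventually_early_small by (auto simp: eventually_sequentially)
  define q where "q = deg orig"
  have q: "0 \<le> q" by (simp add: q_def)
  define A where "A = (6 * q * C * 1024 + 2 * q * (C0\<^sup>2 * \<kappa>)) * (2 * D)"
  have A: "0 \<le> A" using q C(1) D_pos \<kappa>_pos by (simp add: A_def)
  have "spine_sq (2 * \<tau> s) (32 ^ s) \<le> (C0 + A) / real (hgt s)" if s: "max (Suc s0) s2 \<le> s" for s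
  proof -
    obtain t where t: "s = Suc t" "s0 \<le> t" using s by (cases s) auto
    define r h where "r = (32::nat) ^ t" and "h = hgt t"
    define T1 where "T1 = (2 * 512 ^ s :: nat)"
    define eps where "eps = exp (2 - (4 / 3) ^ s / 32 :: real)"
    have hp: "1 \<le> h" and hf: "real h \<le> f (int r)"
      using hgt_pos[OF t(2)] hgt_le[of t] by (auto simp: h_def r_def)
    have gs: "0 < real (hgt s)" using hgt_pos[of s] t by simp
    have rh: "0 < real r * real h" using hp by (simp add: r_def)
    \<comment> \<open>From \<open>(32 ^ s, 0)\<close> to the foot of a tooth in the rectangle, then up the tooth to \<open>(x, y)\<close>.\<close>
    have one: "spine_sq (2 * \<tau> s) (32 ^ s)
      \<le> real T1 * eps\<^sup>2 + (\<Sum>m=T1..<2*\<tau> s. 2 * (w m (int x) (int y))\<^sup>2 + 2 * (w m (int x) 0 - w m (int x) (int y))\<^sup>2)"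
      if x: "x \<in> {r..<2*r}" for x y
    proof -
      have "spine_sq (2 * \<tau> s) (32 ^ s) \<le> spine_sq (2 * \<tau> s) (int x)"
      proof (rule spine_sq_decreasing)
        have "int x \<le> int (2 * r)" using x by auto
        also have "\<dots> \<le> 32 ^ s" by (simp add: r_def t)
        finally show "int x \<le> 32 ^ s" .
      qed simp
      also have "\<dots> \<le> (\<Sum>m\<in>{..<T1} \<union> {T1..<2*\<tau> s}. (trans_prob N m (int x, 0) orig)\<^sup>2)"
        unfolding spine_sq_def by (intro sum_mono2) auto
      also have "\<dots> = (\<Sum>m<T1. (trans_prob N m (int x, 0) orig)\<^sup>2)
          + (\<Sum>m=T1..<2*\<tau> s. (trans_prob N m (int x, 0) orig)\<^sup>2)"
        by (intro sum.union_disjoint) auto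
      also have "\<dots> \<le> real T1 * eps\<^sup>2
          + (\<Sum>m=T1..<2*\<tau> s. 2 * (w m (int x) (int y))\<^sup>2 + 2 * (w m (int x) 0 - w m (int x) (int y))\<^sup>2)"
      proof (intro add_mono sum_mono)
        have "int r \<le> int x" using x by simp
        hence "32 ^ t \<le> int x" by (simp add: r_def)
        hence "trans_prob N m (int x, 0) orig \<le> eps" if "m < T1" for m
          using early_trans_prob_le[of m s t "int x"] that t by (simp add: T1_def eps_def)
        hence "(\<Sum>m<T1. (trans_prob N m (int x, 0) orig)\<^sup>2) \<le> real (card {..<T1}) * eps\<^sup>2"
          by (intro sum_bounded_above power_mono) (auto simp: trans_prob_nonneg)
        thus "(\<Sum>m<T1. (trans_prob N m (int x, 0) orig)\<^sup>2) \<le> real T1 * eps\<^sup>2" by simp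
        fix m
        have "(trans_prob N m (int x, 0) orig)\<^sup>2 \<le> (w m (int x) 0)\<^sup>2"
          using trans_prob_le_smooth trans_prob_nonneg by (intro power_mono) auto
        also have "\<dots> \<le> 2 * (w m (int x) (int y))\<^sup>2 + 2 * (w m (int x) (int y) - w m (int x) 0)\<^sup>2"
          by (rule square_le_double)
        finally show "(trans_prob N m (int x, 0) orig)\<^sup>2
          \<le> 2 * (w m (int x) (int y))\<^sup>2 + 2 * (w m (int x) 0 - w m (int x) (int y))\<^sup>2"
          by (simp add: power2_commute)
      qed
      finally show ?thesis .
    qed
    have "real r * real h * spine_sq (2 * \<tau> s) (32 ^ s)
        = (\<Sum>x=r..<2*r. \<Sum>y<h. spine_sq (2 * \<tau> s) (32 ^ s))" by simp
    also have "\<dots> \<le> (\<Sum>x=r..<2*r. \<Sum>y<h. real T1 * eps\<^sup>2 +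
        (\<Sum>m=T1..<2*\<tau> s. 2 * (w m (int x) (int y))\<^sup>2 + 2 * (w m (int x) 0 - w m (int x) (int y))\<^sup>2))"
      by (intro sum_mono one)
    also have "\<dots> = real r * real h * (real T1 * eps\<^sup>2) + (\<Sum>m=T1..<2*\<tau> s.
        2 * (\<Sum>x=r..<2*r. \<Sum>y<h. (w m (int x) (int y))\<^sup>2)
        + 2 * (\<Sum>x=r..<2*r. \<Sum>y<h. (w m (int x) 0 - w m (int x) (int y))\<^sup>2))"
      by (simp add: sum.distrib sum_distrib_left sum.swap[of _ "{T1..<2*\<tau> s}"])
    also have "\<dots> \<le> real r * real h * (real T1 * eps\<^sup>2)
        + (\<Sum>m=T1..<2*\<tau> s. 2 * (3 * q * ret0 m) + 2 * ((real h)\<^sup>2 * energy m))"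
      unfolding q_def
      by (intro add_left_mono sum_mono add_mono mult_left_mono rectangle_sq_le[OF hf] teeth_oscillation[OF hf]) auto
    also have "\<dots> = real r * real h * (real T1 * eps\<^sup>2)
        + (6 * q * (\<Sum>m=T1..<2*\<tau> s. ret0 m) + 2 * (real h)\<^sup>2 * (\<Sum>m=T1..<2*\<tau> s. energy m))"
      by (simp add: sum.distrib sum_distrib_left mult_ac)
    also have "\<dots> \<le> real r * real h * (real T1 * eps\<^sup>2)
        + (6 * q * (C * 32 ^ Suc s) + 2 * (C0 * 45 ^ t)\<^sup>2 * (q * (\<kappa> / 64 ^ s)))"
    proof (intro add_left_mono add_mono mult_left_mono mult_mono power_mono)
      have "(\<Sum>m=T1..<2*\<tau> s. ret0 m) \<le> (\<Sum>m<\<tau> (Suc s). ret0 m)"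
        using \<tau>_Suc_ge[of s] t by (intro sum_mono2) (auto simp: ret_nonneg)
      also have "\<dots> \<le> C * 32 ^ Suc s" using t by (intro C) auto
      finally show "(\<Sum>m=T1..<2*\<tau> s. ret0 m) \<le> C * 32 ^ Suc s" .
      show "real h \<le> C0 * 45 ^ t" unfolding h_def by (rule hgt_poly[OF t(2)])
      have "(\<Sum>m=T1..<2*\<tau> s. energy m) \<le> q * ret0 T1" unfolding q_def by (rule sum_energy_le)
      also have "\<dots> \<le> q * (\<kappa> / 64 ^ s)"
        using q t by (intro mult_left_mono ret_le_early) (auto simp: T1_def)
      finally show "(\<Sum>m=T1..<2*\<tau> s. energy m) \<le> q * (\<kappa> / 64 ^ s)" .
    qed (use q energy_nonneg C0_pos in \<open>auto intro: sum_nonneg\<close>)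
    \<comment> \<open>The energy term is of order \<open>45 ^ (2 * t) / 64 ^ t \<le> 32 ^ t\<close>.\<close>
    also have "\<dots> \<le> real r * real h * (real T1 * eps\<^sup>2)
        + (6 * q * C * 1024 + 2 * q * (C0\<^sup>2 * \<kappa>)) * real r"
    proof -
      have "((45::real) ^ t)\<^sup>2 * (1 / 64 ^ s) \<le> 32 ^ t"
      proof -
        have "((45::real) ^ t)\<^sup>2 = 2025 ^ t" by (simp add: power2_eq_square flip: power_mult_distrib)
        also have "\<dots> \<le> 2048 ^ t" by (intro power_mono) auto
        also have "\<dots> = 32 ^ t * 64 ^ t" by (simp flip: power_mult_distrib)
        also have "\<dots> \<le> 32 ^ t * 64 ^ s" by (simp add: t)
        finally show ?thesis by (simp add: divide_le_eq)
      qed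
      hence "2 * q * (C0\<^sup>2 * \<kappa>) * (((45::real) ^ t)\<^sup>2 * (1 / 64 ^ s)) \<le> 2 * q * (C0\<^sup>2 * \<kappa>) * 32 ^ t"
        using q \<kappa>_pos by (intro mult_left_mono) auto
      thus ?thesis by (simp add: r_def t power_mult_distrib algebra_simps)
    qed
    also have "\<dots> = (real T1 * eps\<^sup>2 + (6 * q * C * 1024 + 2 * q * (C0\<^sup>2 * \<kappa>)) / real h) * (real r * real h)"
    proof -
      have "Y / real h * (real r * real h) = Y * real r" for Y using hp by simp
      thus ?thesis by (simp only: distrib_right mult.commute[of "real r * real h"])
    qed
    finally have "spine_sq (2 * \<tau> s) (32 ^ s) * (real r * real h)
      \<le> (real T1 * eps\<^sup>2 + (6 * q * C * 1024 + 2 * q * (C0\<^sup>2 * \<kappa>)) / real h) * (real r * real h)"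
      by (simp only: mult.commute)
    hence "spine_sq (2 * \<tau> s) (32 ^ s) \<le> real T1 * eps\<^sup>2 + (6 * q * C * 1024 + 2 * q * (C0\<^sup>2 * \<kappa>)) / real h"
      by (rule mult_right_le_imp_le[OF _ rh])
    also have "\<dots> \<le> C0 / real (hgt s) + A / real (hgt s)"
    proof (intro add_mono)
      have "real T1 * eps\<^sup>2 * real (hgt s) \<le> real T1 * eps\<^sup>2 * (C0 * 45 ^ s)"
        using t by (intro mult_left_mono hgt_poly) auto
      also have "\<dots> = C0 * (2 * 512 ^ s * eps\<^sup>2 * 45 ^ s)" by (simp add: T1_def)
      also have "\<dots> \<le> C0 * 1" unfolding eps_def using C0_pos s by (intro mult_left_mono s2) auto
      finally show "real T1 * eps\<^sup>2 \<le> C0 / real (hgt s)" using gs by (simp add: pos_le_divide_eq)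
      have "real (hgt s) \<le> 2 * D * real h" using hgt_doubling[OF t(2)] by (simp add: h_def t)
      hence "1 / real h \<le> 2 * D / real (hgt s)" using gs hp by (simp add: field_simps)
      hence "(6 * q * C * 1024 + 2 * q * (C0\<^sup>2 * \<kappa>)) * (1 / real h)
        \<le> (6 * q * C * 1024 + 2 * q * (C0\<^sup>2 * \<kappa>)) * (2 * D / real (hgt s))"
        using q C \<kappa>_pos by (intro mult_left_mono) auto
      thus "(6 * q * C * 1024 + 2 * q * (C0\<^sup>2 * \<kappa>)) / real h \<le> A / real (hgt s)"
        by (simp add: A_def)
    qed
    finally show ?thesis by (simp add: add_divide_distrib)
  qed
  thus ?thesis using A C0_pos
    by (intro exI[of _ "C0 + A"] conjI exI[of _ "max (Suc s0) s2"]) auto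
qed

lemma spine_sq_le:
  "\<exists>C\<ge>0. \<exists>s1\<ge>s0. \<forall>s\<ge>s1. \<forall>T. spine_sq T (32 ^ s) \<le> C / real (hgt s)"
proof -
  obtain C s1 where C: "0 \<le> C" "s0 \<le> s1"
    "\<And>s. s1 \<le> s \<Longrightarrow> spine_sq (2 * \<tau> s) (32 ^ s) \<le> C / real (hgt s)"
    using early_spine_sq_le by blast
  define B where "B = 131072 * D * \<kappa>\<^sup>2 + \<kappa>\<^sup>2"
  have "0 \<le> B" using D_pos by (simp add: B_def)
  moreover have "spine_sq T (32 ^ s) \<le> (C + B) / real (hgt s)" if s: "s1 \<le> s" for s T
  proof -
    have "spine_sq T (32 ^ s) \<le> (\<Sum>m\<in>{..<2*\<tau> s} \<union> {2*\<tau> s..<T}. (trans_prob N m (32 ^ s, 0) orig)\<^sup>2)"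
      unfolding spine_sq_def by (intro sum_mono2) auto
    also have "\<dots> = spine_sq (2 * \<tau> s) (32 ^ s) + (\<Sum>m=2*\<tau> s..<T. (trans_prob N m (32 ^ s, 0) orig)\<^sup>2)"
      unfolding spine_sq_def by (intro sum.union_disjoint) auto
    also have "\<dots> \<le> C / real (hgt s) + B / real (hgt s)"
      unfolding B_def using s C by (intro add_mono C late_spine_sq_le) auto
    finally show ?thesis by (simp add: add_divide_distrib)
  qed
  ultimately show ?thesis using C(1,2) by (intro exI[of _ "C + B"] conjI exI[of _ s1]) auto
qed

lemma spine_sq_root_bounded: "\<exists>C\<ge>0. \<forall>T. spine_sq T 0 \<le> C"
proof -
  define S where "S = (\<Sum>m<2*\<tau> s0. (trans_prob N m orig orig)\<^sup>2)"
  define B where "B = 8 * (2 * (8192 * D * \<kappa>\<^sup>2 / real (hgt s0)))"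
  have "spine_sq T 0 \<le> S + B" for T
  proof -
    have "spine_sq T 0 \<le> (\<Sum>m\<in>{..<2*\<tau> s0} \<union> {2*\<tau> s0..<T}. (trans_prob N m orig orig)\<^sup>2)"
      unfolding spine_sq_def by (intro sum_mono2) auto
    also have "\<dots> = S + (\<Sum>m=2*\<tau> s0..<T. (trans_prob N m orig orig)\<^sup>2)"
      unfolding S_def by (intro sum.union_disjoint) auto
    also have "(\<Sum>m=2*\<tau> s0..<T. (trans_prob N m orig orig)\<^sup>2) \<le> (\<Sum>m=2*\<tau> s0..<T. 8 * (ret0 (m div 2))\<^sup>2)"
    proof (rule sum_mono)
      fix m
      have "(trans_prob N m orig orig)\<^sup>2 \<le> (2 * ret0 (m div 2))\<^sup>2"
        using trans_prob_le_smooth[of m orig orig] smooth_root[OF root_nbrs, of m]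
        by (intro power_mono) (auto simp: trans_prob_nonneg)
      thus "(trans_prob N m orig orig)\<^sup>2 \<le> 8 * (ret0 (m div 2))\<^sup>2"
        by (rule order_trans) (simp add: power_mult_distrib)
    qed
    also have "\<dots> \<le> B"
      using sum_div2_le[of "\<lambda>m. (ret0 m)\<^sup>2" "\<tau> s0" T] sum_ret_sq_le[of s0 T]
      by (simp add: B_def flip: sum_distrib_left)
    finally show ?thesis by simp
  qed
  moreover have "0 \<le> S + B"
    unfolding S_def B_def using D_pos by (intro add_nonneg_nonneg sum_nonneg) auto
  ultimately show ?thesis by blast
qed

end

section \<open>The weighted number of collisions\<close>

context growing_wedge
begin

lemma column_weight: "(\<Sum>y\<in>{- int h..int h}. weight (x, y)) = 1 + 2 * harm h"
proof (induction h)
  case 0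
  show ?case by (simp add: weight_def harm_def)
next
  case (Suc h)
  have "{- int (Suc h)..int (Suc h)} = insert (int (Suc h)) (insert (- int (Suc h)) {- int h..int h})"
    by auto
  thus ?case using Suc by (simp add: weight_def harm_Suc max_def inverse_eq_divide)
      (simp add: field_simps)
qed

lemma column_weight_le: "\<exists>C\<ge>0. \<forall>s\<ge>max 1 s0. \<forall>x. (\<Sum>y\<in>{- int (hgt (Suc s))..int (hgt (Suc s))}. weight (x, y)) \<le> C * real s"
proof -
  define C where "C = 3 + 2 * (\<bar>ln C0\<bar> + 2 * ln 45)"
  have "(\<Sum>y\<in>{- int (hgt (Suc s))..int (hgt (Suc s))}. weight (x, y)) \<le> C * real s" if s: "max 1 s0 \<le> s" for s x
  proof -
    have gp: "1 \<le> hgt (Suc s)" using s by (intro hgt_pos) auto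
    have "ln (real (hgt (Suc s))) \<le> ln (C0 * 45 ^ Suc s)"
      using gp hgt_poly[of "Suc s"] s C0_pos by (subst ln_le_cancel_iff) auto
    also have "\<dots> = ln C0 + real (Suc s) * ln 45"
      using C0_pos by (simp add: ln_mult ln_realpow del: power_Suc)
    also have "\<dots> \<le> \<bar>ln C0\<bar> * real s + (2 * real s) * ln 45"
    proof (intro add_mono mult_right_mono)
      have "\<bar>ln C0\<bar> * 1 \<le> \<bar>ln C0\<bar> * real s" using s by (intro mult_left_mono) auto
      thus "ln C0 \<le> \<bar>ln C0\<bar> * real s" by linarith
    qed (use s in auto)
    finally have "1 + 2 * harm (hgt (Suc s)) \<le> 3 * 1 + 2 * (\<bar>ln C0\<bar> * real s + (2 * real s) * ln 45)"
      using harm_le_ln[OF gp] by simp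
    also have "\<dots> \<le> 3 * real s + 2 * (\<bar>ln C0\<bar> * real s + (2 * real s) * ln 45)" using s by simp
    also have "\<dots> = C * real s" by (simp add: C_def algebra_simps)
    finally show ?thesis by (simp only: column_weight)
  qed
  moreover have "0 \<le> C" by (simp add: C_def)
  ultimately show ?thesis by blast
qed

definition box :: "nat \<Rightarrow> (int \<times> int) set" where
  "box s = {a \<in> comb_verts f. \<bar>fst a\<bar> < 32 ^ s}"

lemma abs_height_le:
  assumes "(x, y) \<in> comb_verts f" "\<bar>x\<bar> \<le> 32 ^ s"
  shows "\<bar>y\<bar> \<le> int (hgt s)"
proof -
  have "f \<bar>x\<bar> \<le> f (32 ^ s)" using assms(2) by (intro f_mono) auto
  moreover have "f \<bar>x\<bar> = f x" using f_even[of x] by (simp add: abs_if)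
  ultimately have "real_of_int \<bar>y\<bar> \<le> f (32 ^ s)" using assms(1) by (simp add: vert_iff)
  hence "\<bar>y\<bar> \<le> \<lfloor>f (32 ^ s)\<rfloor>" by (simp add: le_floor_iff)
  thus ?thesis unfolding hgt_def by linarith
qed

lemma box_subset: "box s \<subseteq> {- (32 ^ s)<..<32 ^ s} \<times> {- int (hgt s)..int (hgt s)}"
proof
  fix a assume "a \<in> box s"
  moreover obtain x y where a: "a = (x, y)" by (cases a)
  ultimately show "a \<in> {- (32 ^ s)<..<32 ^ s} \<times> {- int (hgt s)..int (hgt s)}"
    using abs_height_le[of x y s] by (auto simp: box_def)
qed

lemma box_mono:
  assumes "s \<le> t" shows "box s \<subseteq> box t"
proof
  fix a assume a: "a \<in> box s"
  hence "\<bar>fst a\<bar> < 32 ^ s" by (simp add: box_def)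
  also have "(32::int) ^ s \<le> 32 ^ t" using assms by (rule power_increasing) simp
  finally show "a \<in> box t" using a by (simp add: box_def)
qed

lemma finite_box: "finite (box s)"
  by (rule finite_subset[OF box_subset]) auto

text \<open>
  At the scale \<open>32 ^ s\<close> there are of order \<open>32 ^ s\<close> teeth, each of them
  contributes \<open>O(1 / f (32 ^ s))\<close> times its total weight, and the latter is at most
  of order \<open>s\<close> by \<open>column_weight_le\<close>. The finitely many teeth below the
  first scale are controlled by the root.
\<close>

lemma weighted_sq_le:
  assumes sm: "summable (\<lambda>s. real s * 32 ^ s / f (32 ^ s))"
  shows "\<exists>K. \<forall>T s. (\<Sum>a\<in>box s. (\<Sum>n<T. (trans_prob N n a orig)\<^sup>2) * weight a) \<le> K"
proof -
  define F where "F T a = (\<Sum>n<T. (trans_prob N n a orig)\<^sup>2) * weight a" for T a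
  have F0: "0 \<le> F T a" for T a
    unfolding F_def using weight_pos[of a] by (intro mult_nonneg_nonneg sum_nonneg) auto
  have F_le: "F T (x, y) \<le> spine_sq T x * weight (x, y)" for T x y
    unfolding F_def using weight_pos[of "(x, y)"] by (intro mult_right_mono tooth_sq_le_spine_sq) auto
  obtain C s1 where C: "0 \<le> C" "s0 \<le> s1" "\<And>s T. s1 \<le> s \<Longrightarrow> spine_sq T (32 ^ s) \<le> C / real (hgt s)"
    using spine_sq_le by blast
  obtain C' where C': "0 \<le> C'" "\<And>s x. max 1 s0 \<le> s \<Longrightarrow>
      (\<Sum>y\<in>{- int (hgt (Suc s))..int (hgt (Suc s))}. weight (x, y)) \<le> C' * real s"
    using column_weight_le by blast
  obtain C0 where C0: "0 \<le> C0" "\<And>T. spine_sq T 0 \<le> C0"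
    using spine_sq_root_bounded by blast
  define s2 where "s2 = max 1 s1"
  define K0 where "K0 = (\<Sum>a\<in>box s2. C0 * weight a)"
  define c where "c s = 128 * C * C' * (real s * 32 ^ s / f (32 ^ s))" for s
  have c0: "0 \<le> c s" for s unfolding c_def using C C' f_nonneg by auto
  have core: "(\<Sum>a\<in>box s2. F T a) \<le> K0" for T
  proof -
    have "F T a \<le> C0 * weight a" for a
    proof -
      obtain x y where a: "a = (x, y)" by (cases a)
      have "spine_sq T x \<le> spine_sq T 0"
        using spine_sq_decreasing[of 0 "\<bar>x\<bar>" T] by (simp add: spine_sq_abs)
      hence "spine_sq T x \<le> C0" using C0(2)[of T] by linarith
      hence "spine_sq T x * weight a \<le> C0 * weight a"
        using weight_pos[of a] by (intro mult_right_mono) auto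
      thus ?thesis using F_le[of T x y] a by simp
    qed
    thus ?thesis unfolding K0_def by (intro sum_mono)
  qed
  have layer: "(\<Sum>a\<in>box (Suc s) - box s. F T a) \<le> c s" if s: "s2 \<le> s" for s T
  proof -
    have gs: "0 < real (hgt s)" "0 < f (32 ^ s)" "f (32 ^ s) \<le> 2 * real (hgt s)"
    proof -
      have "s0 \<le> s" using s C(2) by (simp add: s2_def)
      hence "1 \<le> real (hgt s)" "1 \<le> f (32 ^ s)" using hgt_pos[of s] height_pos[of s] by auto
      thus "0 < real (hgt s)" "0 < f (32 ^ s)" "f (32 ^ s) \<le> 2 * real (hgt s)"
        using hgt_gt[of s] by linarith+
    qed
    let ?W = "{- (32 ^ Suc s)<..<32 ^ Suc s} \<times> {- int (hgt (Suc s))..int (hgt (Suc s))} :: (int \<times> int) set"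
    have "(\<Sum>a\<in>box (Suc s) - box s. F T a) \<le> (\<Sum>a\<in>box (Suc s) - box s. C / real (hgt s) * weight a)"
    proof (rule sum_mono)
      fix a assume a: "a \<in> box (Suc s) - box s"
      obtain x y where xy: "a = (x, y)" by (cases a)
      have "32 ^ s \<le> \<bar>x\<bar>" using a by (auto simp: box_def xy)
      hence "spine_sq T x \<le> spine_sq T (32 ^ s)"
        using spine_sq_decreasing[of "32 ^ s" "\<bar>x\<bar>" T] by (simp add: spine_sq_abs)
      hence "spine_sq T x \<le> C / real (hgt s)" using C(3)[of s T] s by (simp add: s2_def)
      hence "spine_sq T x * weight a \<le> C / real (hgt s) * weight a"
        using weight_pos[of a] by (intro mult_right_mono) auto
      thus "F T a \<le> C / real (hgt s) * weight a" using F_le[of T x y] xy by simp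
    qed
    also have "\<dots> \<le> (\<Sum>a\<in>?W. C / real (hgt s) * weight a)"
      using box_subset[of "Suc s"] C(1) weight_pos by (intro sum_mono2) (auto simp: less_imp_le)
    also have "\<dots> = C / real (hgt s) * (\<Sum>x\<in>{- (32 ^ Suc s)<..<32 ^ Suc s}.
        \<Sum>y\<in>{- int (hgt (Suc s))..int (hgt (Suc s))}. weight (x, y))"
      by (simp only: sum_distrib_left sum.cartesian_product case_prod_unfold prod.collapse)
    also have "\<dots> \<le> C / real (hgt s) * (real (card {- (32 ^ Suc s)<..<32 ^ Suc s :: int}) * (C' * real s))"
      using C(1) C'(2)[of s] s C(2)
      by (intro mult_left_mono sum_bounded_above) (auto simp: s2_def)
    also have "\<dots> \<le> C / real (hgt s) * (64 * 32 ^ s * (C' * real s))"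
      using C(1) C'(1) by (intro mult_left_mono mult_right_mono) auto
    also have "\<dots> = 64 * C * C' * (real s * 32 ^ s) * (1 / real (hgt s))" by simp
    also have "\<dots> \<le> 64 * C * C' * (real s * 32 ^ s) * (2 / f (32 ^ s))"
      using gs C(1) C'(1) by (intro mult_left_mono) (auto simp: field_simps)
    also have "\<dots> = c s" by (simp add: c_def)
    finally show ?thesis .
  qed
  have sc: "summable c" unfolding c_def using sm by (intro summable_mult)
  have "(\<Sum>a\<in>box s. F T a) \<le> K0 + suminf c" for T s
  proof -
    have "(\<Sum>a\<in>box (s2 + k). F T a) \<le> K0 + (\<Sum>j=s2..<s2 + k. c j)" for k
    proof (induction k)
      case (Suc k)
      have sub: "box (s2 + k) \<subseteq> box (s2 + Suc k)" by (rule box_mono) simp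
      have "(\<Sum>a\<in>box (s2 + Suc k). F T a)
          = (\<Sum>a\<in>box (Suc (s2 + k)) - box (s2 + k). F T a) + (\<Sum>a\<in>box (s2 + k). F T a)"
        using sum.subset_diff[OF sub finite_box, of "F T"] by simp
      also have "\<dots> \<le> c (s2 + k) + (K0 + (\<Sum>j=s2..<s2 + k. c j))"
        by (intro add_mono layer Suc.IH) simp
      finally show ?case by simp
    qed (use core in simp)
    from this[of s] have "(\<Sum>a\<in>box (s2 + s). F T a) \<le> K0 + (\<Sum>j=s2..<s2 + s. c j)" .
    also have "(\<Sum>j=s2..<s2 + s. c j) \<le> suminf c"
      using sc c0 by (intro sum_le_suminf) auto
    finally have "(\<Sum>a\<in>box (s2 + s). F T a) \<le> K0 + suminf c" by simp
    moreover have "(\<Sum>a\<in>box s. F T a) \<le> (\<Sum>a\<in>box (s2 + s). F T a)"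
      using F0 by (intro sum_mono2 finite_box box_mono) auto
    ultimately show ?thesis by linarith
  qed
  thus ?thesis unfolding F_def by blast
qed

text \<open>
  Transfer from the root to the starting vertex \<open>v\<close>: the root reaches
  \<open>v\<close> within a fixed number of steps with positive probability, and by reversibility
  start and target may be exchanged at the cost of a bounded degree ratio.
\<close>

lemma weighted_collisions_le:
  assumes sm: "summable (\<lambda>s. real s * 32 ^ s / f (32 ^ s))" and v: "v \<in> comb_verts f"
  shows "\<exists>K. \<forall>T B. finite B \<longrightarrow> (\<Sum>n<T. \<Sum>a\<in>B. (trans_prob N n v a)\<^sup>2 * weight a) \<le> K"
proof -
  obtain K where K: "\<And>T s. (\<Sum>a\<in>box s. (\<Sum>n<T. (trans_prob N n a orig)\<^sup>2) * weight a) \<le> K"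
    using weighted_sq_le[OF sm] by blast
  obtain d where d: "trans_prob N d v orig > 0" using reaches_root[OF v] .
  define p where "p = trans_prob N d v orig"
  define Q where "Q = (4 / p)\<^sup>2"
  have p: "0 < p" using d by (simp add: p_def)
  have tp: "(trans_prob N n v a)\<^sup>2 \<le> Q * (trans_prob N (n + d) a orig)\<^sup>2" if "a \<in> comb_verts f" for n a
  proof -
    have "trans_prob N n v a \<le> deg v * trans_prob N n v a"
      using mult_right_mono[OF deg_ge_1[OF v] trans_prob_nonneg] by simp
    also have "\<dots> = deg a * trans_prob N n a v" by (rule trans_prob_reversible)
    also have "\<dots> \<le> 4 * trans_prob N n a v" by (intro mult_right_mono deg_le_4 trans_prob_nonneg)
    also have "trans_prob N n a v \<le> trans_prob N (n + d) a orig / p"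
      using trans_prob_add_ge[of N n a v d orig] p by (simp add: p_def pos_le_divide_eq)
    finally have "trans_prob N n v a \<le> 4 / p * trans_prob N (n + d) a orig" by simp
    hence "(trans_prob N n v a)\<^sup>2 \<le> (4 / p * trans_prob N (n + d) a orig)\<^sup>2"
      by (intro power_mono trans_prob_nonneg)
    thus ?thesis by (simp only: power_mult_distrib Q_def)
  qed
  have out: "trans_prob N n v a = 0" if "a \<notin> comb_verts f" for n a
    using trans_prob_reversible[of v n a] deg_ge_1[OF v] nbrs_outside[OF that] by auto
  have "(\<Sum>n<T. \<Sum>a\<in>B. (trans_prob N n v a)\<^sup>2 * weight a) \<le> Q * K" if B: "finite B" for T B
  proof -
    obtain s where s: "B \<inter> comb_verts f \<subseteq> box s"
    proof -
      define m where "m = nat (Max (insert 0 ((\<lambda>a. \<bar>fst a\<bar>) ` B)))"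
      have "\<bar>fst a\<bar> < 32 ^ m" if "a \<in> B" for a
      proof -
        have "\<bar>fst a\<bar> \<le> Max (insert 0 ((\<lambda>a. \<bar>fst a\<bar>) ` B))" using B that by (intro Max_ge) auto
        hence "\<bar>fst a\<bar> \<le> int m" unfolding m_def by linarith
        also have "int m < 2 ^ m" by (metis less_exp of_nat_less_iff of_nat_numeral of_nat_power)
        also have "(2::int) ^ m \<le> 32 ^ m" by (intro power_mono) auto
        finally show ?thesis .
      qed
      hence "B \<inter> comb_verts f \<subseteq> box m" by (auto simp: box_def)
      thus ?thesis by (rule that)
    qed
    have "(\<Sum>n<T. \<Sum>a\<in>B. (trans_prob N n v a)\<^sup>2 * weight a)
      = (\<Sum>n<T. \<Sum>a\<in>B \<inter> comb_verts f. (trans_prob N n v a)\<^sup>2 * weight a)"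
      using B out by (intro sum.cong refl sum.mono_neutral_right) auto
    also have "\<dots> \<le> (\<Sum>n<T. \<Sum>a\<in>box s. (trans_prob N n v a)\<^sup>2 * weight a)"
      using s weight_pos by (intro sum_mono sum_mono2 finite_box) (auto simp: less_imp_le)
    also have "\<dots> \<le> (\<Sum>n<T. \<Sum>a\<in>box s. Q * (trans_prob N (n + d) a orig)\<^sup>2 * weight a)"
      using weight_pos by (intro sum_mono mult_right_mono tp) (auto simp: less_imp_le box_def)
    also have "\<dots> = Q * (\<Sum>a\<in>box s. (\<Sum>n<T. (trans_prob N (n + d) a orig)\<^sup>2) * weight a)"
      by (subst sum.swap) (simp add: sum_distrib_left sum_distrib_right mult.assoc)
    also have "\<dots> \<le> Q * (\<Sum>a\<in>box s. (\<Sum>n<T + d. (trans_prob N n a orig)\<^sup>2) * weight a)"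
    proof (intro mult_left_mono sum_mono mult_right_mono)
      fix a
      have "(\<Sum>n<T. (trans_prob N (n + d) a orig)\<^sup>2) = (\<Sum>n=d..<T + d. (trans_prob N n a orig)\<^sup>2)"
        using sum.shift_bounds_nat_ivl[of "\<lambda>n. (trans_prob N n a orig)\<^sup>2" 0 d T]
        by (simp add: lessThan_atLeast0)
      also have "\<dots> \<le> (\<Sum>n<T + d. (trans_prob N n a orig)\<^sup>2)" by (intro sum_mono2) auto
      finally show "(\<Sum>n<T. (trans_prob N (n + d) a orig)\<^sup>2) \<le> (\<Sum>n<T + d. (trans_prob N n a orig)\<^sup>2)" .
    qed (use weight_pos in \<open>auto simp: Q_def less_imp_le\<close>)
    also have "\<dots> \<le> Q * K" by (intro mult_left_mono K) (simp add: Q_def)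
    finally show ?thesis .
  qed
  thus ?thesis by blast
qed

text \<open>
  The hypothesis is Cauchy's condensation of the summability of \<open>log (f x) / f x\<close>
  over the spine, for profiles of polynomial growth.
\<close>

theorem finite_collisions:
  assumes sm: "summable (\<lambda>s. real s * 32 ^ s / f (32 ^ s))"
    and v: "v \<in> comb_verts f" and M: "prob_space M"
    and X: "simple_random_walk M (comb_edges f) v X"
    and X': "simple_random_walk M (comb_edges f) v X'"
    and indep: "indep_processes M X X'"
  shows "AE \<omega> in M. finite {n. X n \<omega> = X' n \<omega>}"
proof -
  interpret M: prob_space M by (rule M)
  have V: "N a \<noteq> {} \<and> N a \<subseteq> comb_verts f" if "a \<in> comb_verts f" for a
    using nbrs_nonempty[OF that] by (cases a) (auto simp: nbr_iff)
  interpret two_walks M "comb_edges f" "comb_verts f" v X X'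
    by unfold_locales (use v V X X' indep in auto)
  obtain K where K: "\<And>T B. finite B \<Longrightarrow> (\<Sum>n<T. \<Sum>a\<in>B. (trans_prob N n v a)\<^sup>2 * weight a) \<le> K"
    using weighted_collisions_le[OF sm v] by blast
  show ?thesis
    by (rule AE_finite_meetings[of weight "1 / 100" K])
       (use weight_pos weighted_collisions_ge K in \<open>auto simp: less_imp_le\<close>)
qed

end

section \<open>The logarithmic profile\<close>

lemma x_log_growing_wedge:
  fixes \<beta> :: real and f :: "int \<Rightarrow> real"
  assumes \<beta>: "\<beta> > 0"
    and f: "\<And>x. f x = real_of_int \<bar>x\<bar> * (ln (real_of_int (max \<bar>x\<bar> 1))) powr \<beta>"
  shows "\<exists>s0. growing_wedge f s0 (32 * 2 powr \<beta>) 1"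
proof -
  define b :: real where "b = ln 32"
  have ln8: "(1::real) \<le> ln 8"
    using ln_ge_iff[of 8 1] exp_le by simp
  have b1: "1 \<le> b" using ln8 unfolding b_def by (rule order_trans) simp
  have f32: "f (32 ^ s) = 32 ^ s * (real s * b) powr \<beta>" for s
    by (simp add: f b_def max_absorb1 ln_realpow)
  have f8: "f (8 ^ s) = 8 ^ s * (real s * ln 8) powr \<beta>" for s
    by (simp add: f max_absorb1 ln_realpow)
  have ev: "\<forall>\<^sub>F s in sequentially. (real s * b) powr \<beta> \<le> (45 / 32) ^ s"
    "\<forall>\<^sub>F s in sequentially. (real s * b) powr \<beta> \<le> 32 ^ s"
    using \<beta> b1 by real_asymp+
  then obtain s0 where s0: "\<And>s. s0 \<le> s \<Longrightarrow> (real s * b) powr \<beta> \<le> (45 / 32) ^ s \<and> (real s * b) powr \<beta> \<le> 32 ^ s"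
    using eventually_conj[OF ev] by (auto simp: eventually_sequentially)
  have "growing_wedge f (max 1 s0) (32 * 2 powr \<beta>) 1"
  proof
    fix x y :: int
    show "0 \<le> f x" by (simp add: f)
    show "f (- x) = f x" by (simp add: f)
    show "f x \<le> f y" if "0 \<le> x" "x \<le> y"
      unfolding f using that \<beta> by (intro mult_mono powr_mono2) (auto simp: max_def)
  next
    fix s assume s: "max 1 s0 \<le> s"
    have sb: "1 \<le> real s * b" using mult_mono[of 1 "real s" 1 b] b1 s by simp
    have pos: "1 \<le> (real s * b) powr \<beta>" using sb \<beta> by (intro ge_one_powr_ge_zero) auto
    show "f (32 ^ s) \<le> 1024 ^ s"
    proof -
      have "32 ^ s * (real s * b) powr \<beta> \<le> 32 ^ s * 32 ^ s"
        using s0[of s] s by (intro mult_left_mono) auto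
      thus ?thesis unfolding f32 by (simp flip: power_mult_distrib)
    qed
    show "8 ^ s \<le> f (8 ^ s)"
    proof -
      have "1 \<le> real s * ln 8" using mult_mono[of 1 "real s" 1 "ln 8"] ln8 s by simp
      hence "1 \<le> (real s * ln 8) powr \<beta>" using \<beta> by (intro ge_one_powr_ge_zero) auto
      thus ?thesis unfolding f8 by simp
    qed
    show "1 \<le> f (32 ^ s)"
      unfolding f32 using mult_mono[of 1 "32 ^ s" 1 "(real s * b) powr \<beta>"] pos by simp
    show "32 * f (32 ^ s) \<le> f (32 ^ Suc s)"
      unfolding f32 using \<beta> b1 by (simp add: mult.assoc) (intro powr_mono2 mult_right_mono, auto)
    show "f (32 ^ Suc s) \<le> 32 * 2 powr \<beta> * f (32 ^ s)"
    proof -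
      have "(real (Suc s) * b) powr \<beta> \<le> (2 * (real s * b)) powr \<beta>"
        using \<beta> b1 s by (intro powr_mono2) (auto simp: algebra_simps)
      also have "\<dots> = 2 powr \<beta> * (real s * b) powr \<beta>"
        by (rule powr_mult)
      finally have "32 ^ Suc s * (real (Suc s) * b) powr \<beta> \<le> 32 ^ Suc s * (2 powr \<beta> * (real s * b) powr \<beta>)"
        by (intro mult_left_mono) auto
      thus ?thesis unfolding f32 by (simp add: mult_ac)
    qed
    show "f (32 ^ s) \<le> 1 * 45 ^ s"
    proof -
      have "32 ^ s * (real s * b) powr \<beta> \<le> 32 ^ s * (45 / 32) ^ s"
        using s0[of s] s by (intro mult_left_mono) auto
      thus ?thesis unfolding f32 by (simp flip: power_mult_distrib)
    qed
  qed
  thus ?thesis by blast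
qed

theorem theorem4p1:
  fixes \<beta> :: real
    and f :: "int \<Rightarrow> real"
    and v :: "int \<times> int"
    and M :: "'a measure"
    and X X' :: "nat \<Rightarrow> 'a \<Rightarrow> int \<times> int"
  assumes "\<beta> > 2"
    and "\<And>x. f x = real_of_int \<bar>x\<bar> * (ln (real_of_int (max \<bar>x\<bar> 1))) powr \<beta>"
    and "v \<in> comb_verts f"
    and "prob_space M"
    and "simple_random_walk M (comb_edges f) v X"
    and "simple_random_walk M (comb_edges f) v X'"
    and "indep_processes M X X'"
  shows "AE \<omega> in M. finite {n. X n \<omega> = X' n \<omega>}"
proof -
  obtain s0 where "growing_wedge f s0 (32 * 2 powr \<beta>) 1"
    using x_log_growing_wedge[OF _ assms(2)] assms(1) by auto
  then interpret growing_wedge f s0 "32 * 2 powr \<beta>" 1 .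
  have "real s * 32 ^ s / f (32 ^ s) = ln 32 powr (- \<beta>) * real s powr (1 - \<beta>)" for s
  proof (cases "s = 0")
    case False
    have "f (32 ^ s) = 32 ^ s * (real s * ln 32) powr \<beta>"
      by (simp add: assms(2) max_absorb1 ln_realpow)
    also have "(real s * ln 32) powr \<beta> = real s powr \<beta> * ln 32 powr \<beta>"
      by (rule powr_mult)
    finally show ?thesis using False by (simp add: powr_diff powr_minus divide_simps)
  qed simp
  moreover have "summable (\<lambda>s. ln 32 powr (- \<beta>) * real s powr (1 - \<beta>))"
    using assms(1) by (intro summable_mult) (simp add: summable_real_powr_iff)
  ultimately have "summable (\<lambda>s. real s * 32 ^ s / f (32 ^ s))" by simp
  thus ?thesis by (rule finite_collisions[OF _ assms(3-7)])
qed

end
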